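(* Let $\boldsymbol{\tau}=(\tau_n:\mathcal A_{n+1}^*\to\mathcal A_n^* )_{n\ge 0}$ be a constant length, recognizable and primitive directive sequence and let $X=X_{\boldsymbol{\tau}}$ be the subshift it generates. Suppose that $\boldsymbol{\tau}$ is $(\mathcal A'_n)_{n\ge 0}$-adapted to an ergodic measure $\mu$ of $(X,S)$. The following conditions are equivalent. (1) The map $\pi_{\mathrm{meq}}:(X,S,\mu)\to(\mathbb Z_{(|\tau_{[0,n)}|)_{n\ge 0}},+1,\nu)$ defines a measure-theoretic isomorphism. (2) For every $n\ge 0$, $\displaystyle\limsup_{N\to+\infty}\frac{|\mathrm{coinc}_{\mathcal A'_N}(\tau_{[n,N)})|}{|\tau_{[n,N)}|}=1$.
   Context: **Directive sequences.** Alphabets are finite nonempty sets; $S$ is the shift $(Sx)_n=x_{n+1}$. A directive sequence is a sequence $\boldsymbol{\tau}=(\tau_n:\mathcal A_{n+1}^*\to\mathcal A_n^* )_{n\ge 0}$ of nonerasing morphisms of free monoids (no letter is mapped to the empty word). For $n<N$, $\tau_{[n,N)}=\tau_n\circ\cdots\circ\tau_{N-1}$; $\tau_{[n,n)}$ is the identity. A morphism $\sigma$ has constant length if the length of $\sigma(a)$ does not depend on the letter $a$; this length is denoted $|\sigma|$. $\boldsymbol{\tau}$ has constant length if every $\tau_n$, $n\ge 0$, does. $\boldsymbol{\tau}$ is primitive if for every $n$ there is $N>n$ such that every letter of $\mathcal A_n$ occurs in $\tau_{[n,N)}(a)$ for every $a\in\mathcal A_N$. Let $\mathcal L^{(n)}(\boldsymbol{\tau})$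 be the set of words over $\mathcal A_n$ occurring in $\tau_{[n,N)}(a)$ for some $N>n$, $a\in\mathcal A_N$; $X^{(n)}_{\boldsymbol{\tau}}$ is the set of $y\in\mathcal A_n^{\mathbb Z}$ all of whose finite factors are in $\mathcal L^{(n)}(\boldsymbol{\tau})$; $X_{\boldsymbol{\tau}}=X^{(0)}_{\boldsymbol{\tau}}$, understood to be nonempty. Morphisms act on bi-infinite sequences by concatenation, the image of the nonnegative coordinates starting at coordinate $0$. For $a\in\mathcal A_n$, $[a]=\{y\in X^{(n)}_{\boldsymbol{\tau}}:y_0=a\}$. $\boldsymbol{\tau}$ is recognizable if for every $n\ge 0$ the family of sets $S^k\tau_{[0,n)}([a])$, $a\in\mathcal A_n$, $0\le k<|\tau_{[0,n)}(a)|$, is a partition of $X_{\boldsymbol{\tau}}$ (sets with distinct indices are disjoint). **Towers and adaptedness.** For $n\ge0$ and $a\in\mathcal A_n$: $B_n(a)=\tau_{[0,n)}([a])$, $\mathcal T_n(a)=\bigcup_{0\le k<|\tau_{[0,n)}(a)|}S^kB_n(a)$, $B_n=\bigcup_{a\in\mathcal A_n}B_n(a)$. Measures are Borel probability measures, and an ergodic measure of $(X,S)$ is an $S$-invariant ergodic one. Given nonempty $\mathcal A'_n\subseteq\mathcal A_n$ ($n\ge 0$), put $\mathcal T'_n=\bigcup_{a\in\mathcal A'_n}\mathcal T_n(a)$. $\boldsymbol{\tau}$ is $(\mathcal A'_n)_{n\ge 0}$-adapted to $\mu$ if $\sum_{n\ge 0}\mu(X_{\boldsymbol{\tau}}\setminus\mathcal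 T'_n)<+\infty$ and there is $\delta>0$ with $\mu(\mathcal T_n(a))\ge\delta$ for all $a\in\mathcal A'_n$, $n\ge 0$. **Odometer and $\pi_{\mathrm{meq}}$.** $\mathbb Z_{(|\tau_{[0,n)}|)_{n\ge 0}}=\varprojlim\mathbb Z/|\tau_{[0,n)}|\mathbb Z$ with the map $+1$ (adding $1$ in each coordinate) and Haar probability measure $\nu$. The map $\pi_{\mathrm{meq}}:X_{\boldsymbol{\tau}}\to\mathbb Z_{(|\tau_{[0,n)}|)_{n\ge 0}}$ is $\pi_{\mathrm{meq}}(x)=(k_n(x))_{n\ge 0}$, where $k_n(x)$ is the unique integer in $[0,|\tau_{[0,n)}|)$ with $x\in S^{k_n(x)}B_n$. **Coincidences.** For a constant length morphism $\sigma:\mathcal A^*\to\mathcal B^*$ and $\mathcal A'\subseteq\mathcal A$, $\mathrm{coinc}_{\mathcal A'}(\sigma)$ is the set of $i\in\{0,\dots,|\sigma|-1\}$ such that the $i$-th letter (indexing from 0) of $\sigma(a)$ is the same for all $a\in\mathcal A'$. *)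

theory Defs
  imports "HOL-Probability.Probability" "HOL-Library.Sublist"
begin

section \<open>Morphisms of free monoids\<close>

text \<open>
  A morphism is given by its values on letters, \<open>\<sigma> :: 'a \<Rightarrow> 'b list\<close>. Alphabets are finite
  subsets of a type, and only the values on letters of the domain alphabet matter.
\<close>

definition extend :: "('a \<Rightarrow> 'b list) \<Rightarrow> 'a list \<Rightarrow> 'b list" where
  "extend \<sigma> w = concat (map \<sigma> w)"

definition constant_length :: "'a set \<Rightarrow> ('a \<Rightarrow> 'b list) \<Rightarrow> bool" where
  "constant_length A \<sigma> \<longleftrightarrow> (\<exists>l. \<forall>a\<in>A. length (\<sigma> a) = l)"

definition morphism_length :: "'a set \<Rightarrow> ('a \<Rightarrow> 'b list) \<Rightarrow> nat" where
  "morphism_length A \<sigma> = (THE l. \<forall>a\<in>A. length (\<sigma> a) = l)"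

text \<open>
  Action on bi-infinite sequences by concatenation:
  \<open>\<dots> \<sigma> (y (-2)) \<sigma> (y (-1)) . \<sigma> (y 0) \<sigma> (y 1) \<dots>\<close>, where the dot marks the cut before coordinate 0.
  If \<open>\<sigma>\<close> is nonerasing, the first (respectively last) \<open>m\<close> letters of the right (left) half are
  contained in the image of the first (last) \<open>m\<close> letters of the corresponding half of \<open>y\<close>, so
  all list accesses below are in range.
\<close>

definition act :: "('a \<Rightarrow> 'b list) \<Rightarrow> (int \<Rightarrow> 'a) \<Rightarrow> (int \<Rightarrow> 'b)" where
  "act \<sigma> y = (\<lambda>i. if 0 \<le> i then extend \<sigma> (map y [0..i]) ! nat i
                  else rev (extend \<sigma> (map y [i..-1])) ! nat (- i - 1))"

definition shift_map :: "(int \<Rightarrow> 'a) \<Rightarrow> (int \<Rightarrow> 'a)" where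
  "shift_map x = (\<lambda>i. x (i + 1))"

definition coinc :: "'a set \<Rightarrow> 'a set \<Rightarrow> ('a \<Rightarrow> 'b list) \<Rightarrow> nat set" where
  "coinc A A' \<sigma> = {i. i < morphism_length A \<sigma> \<and> (\<forall>a\<in>A'. \<forall>b\<in>A'. \<sigma> a ! i = \<sigma> b ! i)}"


section \<open>Directive sequences\<close>

text \<open>\<open>\<tau> n\<close> is a morphism from words over \<open>A (Suc n)\<close> to words over \<open>A n\<close>.\<close>

definition directive_sequence :: "(nat \<Rightarrow> 'a set) \<Rightarrow> (nat \<Rightarrow> 'a \<Rightarrow> 'a list) \<Rightarrow> bool" where
  "directive_sequence A \<tau> \<longleftrightarrow>
     (\<forall>n. finite (A n) \<and> A n \<noteq> {}) \<and>
     (\<forall>n. \<forall>a\<in>A (Suc n). \<tau> n a \<noteq> [] \<and> set (\<tau> n a) \<subseteq> A n)"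

text \<open>\<open>seg \<tau> n N\<close> is \<open>\<tau>\<^bsub>[n,N)\<^esub> = \<tau>\<^sub>n \<circ> \<dots> \<circ> \<tau>\<^bsub>N-1\<^esub>\<close> on letters, the identity for \<open>N \<le> n\<close>.\<close>

primrec seg :: "(nat \<Rightarrow> 'a \<Rightarrow> 'a list) \<Rightarrow> nat \<Rightarrow> nat \<Rightarrow> 'a \<Rightarrow> 'a list" where
  "seg \<tau> n 0 = (\<lambda>a. [a])"
| "seg \<tau> n (Suc N) = (if n \<le> N then (\<lambda>a. extend (seg \<tau> n N) (\<tau> N a)) else (\<lambda>a. [a]))"

definition constant_length_sequence :: "(nat \<Rightarrow> 'a set) \<Rightarrow> (nat \<Rightarrow> 'a \<Rightarrow> 'a list) \<Rightarrow> bool" where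
  "constant_length_sequence A \<tau> \<longleftrightarrow> (\<forall>n. constant_length (A (Suc n)) (\<tau> n))"

definition primitive_sequence :: "(nat \<Rightarrow> 'a set) \<Rightarrow> (nat \<Rightarrow> 'a \<Rightarrow> 'a list) \<Rightarrow> bool" where
  "primitive_sequence A \<tau> \<longleftrightarrow> (\<forall>n. \<exists>N>n. \<forall>b\<in>A n. \<forall>a\<in>A N. b \<in> set (seg \<tau> n N a))"

definition language :: "(nat \<Rightarrow> 'a set) \<Rightarrow> (nat \<Rightarrow> 'a \<Rightarrow> 'a list) \<Rightarrow> nat \<Rightarrow> 'a list set" where
  "language A \<tau> n = {w. \<exists>N>n. \<exists>a\<in>A N. sublist w (seg \<tau> n N a)}"

definition subshift :: "(nat \<Rightarrow> 'a set) \<Rightarrow> (nat \<Rightarrow> 'a \<Rightarrow> 'a list) \<Rightarrow> nat \<Rightarrow> (int \<Rightarrow> 'a) set" where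
  "subshift A \<tau> n = {y. range y \<subseteq> A n \<and> (\<forall>i j. map y [i..j] \<in> language A \<tau> n)}"

definition base :: "(nat \<Rightarrow> 'a set) \<Rightarrow> (nat \<Rightarrow> 'a \<Rightarrow> 'a list) \<Rightarrow> nat \<Rightarrow> 'a \<Rightarrow> (int \<Rightarrow> 'a) set" where
  "base A \<tau> n a = act (seg \<tau> 0 n) ` {y \<in> subshift A \<tau> n. y 0 = a}"

definition level :: "(nat \<Rightarrow> 'a set) \<Rightarrow> (nat \<Rightarrow> 'a \<Rightarrow> 'a list) \<Rightarrow> nat \<Rightarrow> 'a \<times> nat \<Rightarrow> (int \<Rightarrow> 'a) set" where
  "level A \<tau> n = (\<lambda>(a, k). (shift_map ^^ k) ` base A \<tau> n a)"

definition level_indices :: "(nat \<Rightarrow> 'a set) \<Rightarrow> (nat \<Rightarrow> 'a \<Rightarrow> 'a list) \<Rightarrow> nat \<Rightarrow> ('a \<times> nat) set" where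
  "level_indices A \<tau> n = (SIGMA a:A n. {k. k < length (seg \<tau> 0 n a)})"

definition recognizable :: "(nat \<Rightarrow> 'a set) \<Rightarrow> (nat \<Rightarrow> 'a \<Rightarrow> 'a list) \<Rightarrow> bool" where
  "recognizable A \<tau> \<longleftrightarrow>
     (\<forall>n. (\<Union>p\<in>level_indices A \<tau> n. level A \<tau> n p) = subshift A \<tau> 0 \<and>
          disjoint_family_on (level A \<tau> n) (level_indices A \<tau> n))"

definition tower :: "(nat \<Rightarrow> 'a set) \<Rightarrow> (nat \<Rightarrow> 'a \<Rightarrow> 'a list) \<Rightarrow> nat \<Rightarrow> 'a \<Rightarrow> (int \<Rightarrow> 'a) set" where
  "tower A \<tau> n a = (\<Union>k<length (seg \<tau> 0 n a). (shift_map ^^ k) ` base A \<tau> n a)"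

definition total_base :: "(nat \<Rightarrow> 'a set) \<Rightarrow> (nat \<Rightarrow> 'a \<Rightarrow> 'a list) \<Rightarrow> nat \<Rightarrow> (int \<Rightarrow> 'a) set" where
  "total_base A \<tau> n = (\<Union>a\<in>A n. base A \<tau> n a)"

definition adapted :: "(nat \<Rightarrow> 'a set) \<Rightarrow> (nat \<Rightarrow> 'a \<Rightarrow> 'a list) \<Rightarrow> (nat \<Rightarrow> 'a set) \<Rightarrow>
    (int \<Rightarrow> 'a) measure \<Rightarrow> bool" where
  "adapted A \<tau> A' \<mu> \<longleftrightarrow>
     summable (\<lambda>n. measure \<mu> (subshift A \<tau> 0 - (\<Union>a\<in>A' n. tower A \<tau> n a))) \<and>
     (\<exists>\<delta>>0. \<forall>n. \<forall>a\<in>A' n. measure \<mu> (tower A \<tau> n a) \<ge> \<delta>)"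


section \<open>Measure-preserving systems\<close>

definition borel_measure_space :: "'a topology \<Rightarrow> 'a measure" where
  "borel_measure_space X = sigma (topspace X) {U. openin X U}"

definition borel_probability :: "'a topology \<Rightarrow> 'a measure \<Rightarrow> bool" where
  "borel_probability X \<mu> \<longleftrightarrow> prob_space \<mu> \<and> sets \<mu> = sets (borel_measure_space X)"

definition invariant_measure :: "('a \<Rightarrow> 'a) \<Rightarrow> 'a measure \<Rightarrow> bool" where
  "invariant_measure T \<mu> \<longleftrightarrow> T \<in> measurable \<mu> \<mu> \<and> distr \<mu> \<mu> T = \<mu>"

definition ergodic_measure :: "('a \<Rightarrow> 'a) \<Rightarrow> 'a measure \<Rightarrow> bool" where
  "ergodic_measure T \<mu> \<longleftrightarrow> invariant_measure T \<mu> \<and>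
     (\<forall>E\<in>sets \<mu>. T -` E \<inter> space \<mu> = E \<longrightarrow> measure \<mu> E = 0 \<or> measure \<mu> E = 1)"

text \<open>
  \<open>f\<close> defines an isomorphism between the probability-preserving systems \<open>(M, S)\<close> and \<open>(N, T)\<close>:
  it restricts to an equivariant, measure-preserving, bimeasurable bijection between
  forward-invariant measurable sets of full measure.
\<close>

definition measure_isomorphism ::
    "'a measure \<Rightarrow> ('a \<Rightarrow> 'a) \<Rightarrow> 'b measure \<Rightarrow> ('b \<Rightarrow> 'b) \<Rightarrow> ('a \<Rightarrow> 'b) \<Rightarrow> bool" where
  "measure_isomorphism M S N T f \<longleftrightarrow>
     (\<exists>M0\<in>sets M. \<exists>N0\<in>sets N.
        emeasure M M0 = 1 \<and> emeasure N N0 = 1 \<and>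
        S ` M0 \<subseteq> M0 \<and> T ` N0 \<subseteq> N0 \<and>
        bij_betw f M0 N0 \<and>
        f \<in> measurable (restrict_space M M0) (restrict_space N N0) \<and>
        the_inv_into M0 f \<in> measurable (restrict_space N N0) (restrict_space M M0) \<and>
        distr (restrict_space M M0) (restrict_space N N0) f = restrict_space N N0 \<and>
        (\<forall>x\<in>M0. f (S x) = T (f x)))"

text \<open>The topology of the subshift, induced by the product of the discrete topologies.\<close>

definition subshift_topology ::
    "(nat \<Rightarrow> 'a set) \<Rightarrow> (nat \<Rightarrow> 'a \<Rightarrow> 'a list) \<Rightarrow> (int \<Rightarrow> 'a) topology" where
  "subshift_topology A \<tau> =
     subtopology (product_topology (\<lambda>_. discrete_topology (A 0)) UNIV) (subshift A \<tau> 0)"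


section \<open>Odometers\<close>

text \<open>
  The inverse limit of the groups \<open>\<int>/h\<^sub>n\<int>\<close>, where each \<open>h\<^sub>m\<close> divides \<open>h\<^sub>n\<close> for \<open>m \<le> n\<close>. The class of
  an integer modulo \<open>h\<^sub>n\<close> is represented by its residue in \<open>[0, h\<^sub>n)\<close>.
\<close>

definition odometer :: "(nat \<Rightarrow> nat) \<Rightarrow> (nat \<Rightarrow> nat) set" where
  "odometer h = {z. (\<forall>n. z n < h n) \<and> (\<forall>m n. m \<le> n \<longrightarrow> z n mod h m = z m)}"

definition odometer_add :: "(nat \<Rightarrow> nat) \<Rightarrow> (nat \<Rightarrow> nat) \<Rightarrow> (nat \<Rightarrow> nat) \<Rightarrow> (nat \<Rightarrow> nat)" where
  "odometer_add h g z = (\<lambda>n. (g n + z n) mod h n)"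

definition odometer_succ :: "(nat \<Rightarrow> nat) \<Rightarrow> (nat \<Rightarrow> nat) \<Rightarrow> (nat \<Rightarrow> nat)" where
  "odometer_succ h z = (\<lambda>n. (z n + 1) mod h n)"

definition odometer_topology :: "(nat \<Rightarrow> nat) \<Rightarrow> (nat \<Rightarrow> nat) topology" where
  "odometer_topology h =
     subtopology (product_topology (\<lambda>n. discrete_topology {..<h n}) UNIV) (odometer h)"

text \<open>The Haar probability measure: the unique translation-invariant Borel probability measure.\<close>

definition odometer_haar :: "(nat \<Rightarrow> nat) \<Rightarrow> (nat \<Rightarrow> nat) measure" where
  "odometer_haar h = (THE \<nu>. borel_probability (odometer_topology h) \<nu> \<and>
     (\<forall>g\<in>odometer h. invariant_measure (odometer_add h g) \<nu>))"

definition tower_height :: "(nat \<Rightarrow> 'a set) \<Rightarrow> (nat \<Rightarrow> 'a \<Rightarrow> 'a list) \<Rightarrow> nat \<Rightarrow> nat" where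
  "tower_height A \<tau> n = morphism_length (A n) (seg \<tau> 0 n)"

definition pi_meq :: "(nat \<Rightarrow> 'a set) \<Rightarrow> (nat \<Rightarrow> 'a \<Rightarrow> 'a list) \<Rightarrow> (int \<Rightarrow> 'a) \<Rightarrow> (nat \<Rightarrow> nat)" where
  "pi_meq A \<tau> x = (\<lambda>n. THE k. k < tower_height A \<tau> n \<and> x \<in> (shift_map ^^ k) ` total_base A \<tau> n)"

end

(* Recognizability splits X into the levels of the towers of order n, and pi_meq records the height of
   a point in them, so that the pushforward of mu under pi_meq is the Haar measure.

   If pi_meq is an isomorphism, the letter of A_n carried by a point is a measurable function of its
   image in the odometer. Approximating measurable sets of the odometer by cylinders of a high level N,
   this letter is a function of the position in the towers of order N up to a set of small measure.
   Every position at which the towers in A'_N disagree contributes at least delta / h_N to that set,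
   hence most positions are coincidences.

   Conversely, take levels N_j along which the proportion of non-coincidences for n = 0 is summable.
   By Borel-Cantelli, almost every point is eventually in the towers of A'_(N_j), at a coincidence, so
   that its letter at 0 can be read off its image. By equivariance the image determines the point. *)

theory Submission
  imports Defs
begin

section \<open>Words\<close>

text \<open>Two notions are awkward to meet directly. Haar measure is a definite description, so
  uniqueness must be shown: translation invariance forces equal masses on the cylinders of each
  level. An isomorphism asks for a measurable inverse on a measurable set of full measure. This does
  not go through a theorem on injective Borel images: floors of towers are continuous images of
  compact sets, hence closed, and the inverse is written down as the sequence of letters read off
  the integer translates of an odometer point.

  Constant length turns the action of morphisms on sequences into Euclidean division, on which all
  statements about floors rest. An isomorphism in fact makes the proportion of coincidences converge
  to 1, so the limsup in (2) is then a limit.\<close>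

lemma extend_Nil [simp]: "extend \<sigma> [] = []"
  and extend_Cons [simp]: "extend \<sigma> (a # w) = \<sigma> a @ extend \<sigma> w"
  and extend_append [simp]: "extend \<sigma> (u @ v) = extend \<sigma> u @ extend \<sigma> v"
  by (simp_all add: extend_def)

lemma extend_extend: "extend f (extend g w) = extend (\<lambda>a. extend f (g a)) w"
  by (induction w) simp_all

lemma extend_singleton [simp]: "extend (\<lambda>a. [a]) w = w"
  by (induction w) simp_all

lemma set_extend: "set (extend \<sigma> w) = (\<Union>a\<in>set w. set (\<sigma> a))"
  by (auto simp: extend_def)

lemma sublist_extend: "sublist u v \<Longrightarrow> sublist (extend \<sigma> u) (extend \<sigma> v)"
  by (force simp: sublist_def)

lemma length_extend:
  "(\<And>a. a \<in> set w \<Longrightarrow> length (\<sigma> a) = l) \<Longrightarrow> length (extend \<sigma> w) = length w * l"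
  by (induction w) simp_all

lemma nth_extend:
  assumes "\<And>a. a \<in> set w \<Longrightarrow> length (\<sigma> a) = l" and "0 < l" and "i < length w * l"
  shows "extend \<sigma> w ! i = \<sigma> (w ! (i div l)) ! (i mod l)"
  using assms
proof (induction w arbitrary: i)
  case (Cons a w)
  show ?case
  proof (cases "i < l")
    case True
    then show ?thesis using Cons.prems(1) by (simp add: nth_append)
  next
    case False
    then have "i div l = Suc ((i - l) div l)" "i mod l = (i - l) mod l"
      using Cons.prems(2) by (simp_all add: le_div_geq le_mod_geq)
    with False show ?thesis
      using Cons.prems Cons.IH[of "i - l"] by (simp add: nth_append)
  qed
qed simp

text \<open>Constant length turns concatenation into Euclidean division: block
  \<open>i div l\<close>, position \<open>i mod l\<close>. Integer division rounds down, so one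
  formula covers both halves of the sequence; later computations of coordinates go through
  it.\<close>

lemma act_nth:
  assumes len: "\<And>i. length (\<sigma> (y i)) = l" and "0 < l"
  shows "act \<sigma> y i = \<sigma> (y (i div int l)) ! nat (i mod int l)"
proof (cases "0 \<le> i")
  case True
  then obtain k where k: "i = int k" by (metis nonneg_int_cases)
  have "k < length (map y [0..i]) * l"
  proof -
    have "Suc k * 1 \<le> Suc k * l" using \<open>0 < l\<close> by (intro mult_le_mono2) simp
    moreover have "length (map y [0..i]) = Suc k" using k by (simp add: nat_add_distrib)
    ultimately show ?thesis by simp
  qed
  moreover have "k div l < nat (int k + 1)"
    using div_le_dividend[of k l] by linarith
  then have "map y [0..i] ! (k div l) = y (int (k div l))"
    using k by (subst nth_map) (auto simp: nth_upto)
  moreover have "act \<sigma> y i = extend \<sigma> (map y [0..i]) ! k"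
    by (simp add: act_def k)
  ultimately show ?thesis
    using \<open>0 < l\<close> len nth_extend[of "map y [0..i]" \<sigma> l k]
    by (auto simp: k zdiv_int nat_mod_distrib)
next
  case False
  define m where "m = nat (- i)"
  have m: "i = - int m" "0 < m" using False by (auto simp: m_def)
  let ?w = "map y [i..-1]"
  have lw: "length ?w = m" using m by simp
  have le: "length (extend \<sigma> ?w) = m * l"
    using length_extend[of ?w \<sigma> l] len lw by auto
  \<comment> \<open>The letter at \<open>i = - m\<close> is the \<open>m\<close>-th from the right
    end of a word of length \<open>m * l\<close>; this is its index from the left.\<close>
  define p where "p = m * l - m"
  have mle: "m \<le> m * l" using \<open>0 < l\<close> by simp
  have p: "p < m * l" using mle m \<open>0 < l\<close> by (simp add: p_def)
  have ip: "int p = int m * int l + i" using mle m by (simp add: p_def of_nat_diff)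
  have "act \<sigma> y i = rev (extend \<sigma> ?w) ! (m - 1)"
    using False m by (simp add: act_def nat_diff_distrib)
  also have "\<dots> = extend \<sigma> ?w ! p"
    using m mle le[unfolded m(1)] by (subst rev_nth) (auto simp: p_def intro: less_le_trans)
  also have "\<dots> = \<sigma> (?w ! (p div l)) ! (p mod l)"
    using p \<open>0 < l\<close> len lw by (intro nth_extend) auto
  also have "p div l < m" using p \<open>0 < l\<close> by (simp add: less_mult_imp_div_less)
  then have "?w ! (p div l) = y (i + int (p div l))"
    using lw by (subst nth_map) (auto simp: nth_upto m)
  also have "int (p div l) = int m + i div int l"
    using \<open>0 < l\<close> by (simp add: zdiv_int ip)
  also have "p mod l = nat (i mod int l)"
    by (metis ip mod_mult_self3 nat_int zmod_int)
  finally show ?thesis using m by simp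
qed

lemma funpow_shift_map: "(shift_map ^^ k) x = (\<lambda>i. x (i + int k))"
  by (induction k arbitrary: x) (auto simp: shift_map_def fun_eq_iff algebra_simps)

text \<open>Adding a multiple of \<open>l\<close> changes the quotient and keeps the remainder. This
  brings a point that has climbed whole blocks back to the base of a tower.\<close>

lemma funpow_shift_map_act:
  assumes len: "\<And>i. length (\<sigma> (y i)) = l" and "0 < l"
  shows "(shift_map ^^ (l * q)) (act \<sigma> y) = act \<sigma> ((shift_map ^^ q) y)"
proof
  fix i
  have "(i + int (l * q)) div int l = i div int l + int q" "(i + int (l * q)) mod int l = i mod int l"
    using \<open>0 < l\<close> by simp_all
  then show "(shift_map ^^ (l * q)) (act \<sigma> y) i = act \<sigma> ((shift_map ^^ q) y) i"
    by (simp add: funpow_shift_map act_nth[where l=l] len \<open>0 < l\<close> del: of_nat_mult)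
qed

text \<open>Division by \<open>k\<close> followed by division by \<open>l\<close> amounts to
  division by the product, so both sides address the same letter.\<close>

lemma act_act:
  assumes f: "\<And>a. a \<in> B \<Longrightarrow> length (f a) = k" and "0 < k"
    and g: "\<And>i. length (g (y i)) = l" "\<And>i. set (g (y i)) \<subseteq> B" and "0 < l"
  shows "act f (act g y) = act (\<lambda>a. extend f (g a)) y"
proof
  fix i
  have gl: "nat (j mod int l) < l" for j using \<open>0 < l\<close> by (simp add: nat_less_iff)
  have B: "act g y j \<in> B" for j
    using g(2)[of "j div int l"] gl[of j] g(1)[of "j div int l"]
    by (subst act_nth[where l=l]) (auto simp: g \<open>0 < l\<close> subset_iff)
  have len: "length (extend f (g (y j))) = l * k" for j
    using g f by (subst length_extend[where l=k]) auto
  \<comment> \<open>Position inside the image of one letter under the composite: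
    \<open>r div k\<close> selects a letter of the word given by \<open>g\<close>, and
    \<open>r mod k\<close> a letter of the image of that letter under \<open>f\<close>.\<close>
  define r where "r = nat (i mod int (l * k))"
  have r: "int r = i mod int (l * k)" using assms by (simp add: r_def)
  have "r < l * k" using assms by (simp add: r_def nat_less_iff)
  have "act f (act g y) i = f (act g y (i div int k)) ! nat (i mod int k)"
    using B f \<open>0 < k\<close> by (intro act_nth) auto
  also have "act g y (i div int k) = g (y (i div int k div int l)) ! nat (i div int k mod int l)"
    using g \<open>0 < l\<close> by (intro act_nth) auto
  also have "i div int k div int l = i div int (l * k)"
    by (simp add: zdiv_zmult2_eq mult.commute)
  also have "i div int k mod int l = int (r div k)"
    using assms by (simp add: zdiv_int r zmod_zmult2_eq mult.commute[of "int l"])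
  also have "i mod int k = int (r mod k)"
    by (simp add: zmod_int r mod_mod_cancel)
  finally have "act f (act g y) i = f (g (y (i div int (l * k))) ! (r div k)) ! (r mod k)"
    by simp
  also have "\<dots> = extend f (g (y (i div int (l * k)))) ! r"
    using g f \<open>0 < k\<close> \<open>r < l * k\<close> by (subst nth_extend[where l=k]) auto
  also have "\<dots> = act (\<lambda>a. extend f (g a)) y i"
    using len assms by (subst act_nth[where l="l * k"]) (auto simp: r_def)
  finally show "act f (act g y) i = act (\<lambda>a. extend f (g a)) y i" .
qed

text \<open>The blocks containing the two ends, together with those between them, cover the window.
  This keeps images of points of a subshift inside the language of a lower level.\<close>

lemma map_act_sublist:
  assumes len: "\<And>i. length (\<sigma> (y i)) = l" and "0 < l" and "i \<le> j"
  shows "sublist (map (act \<sigma> y) [i..j]) (extend \<sigma> (map y [i div int l..j div int l]))"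
proof -
  define p q where "p = i div int l" and "q = j div int l"
  \<comment> \<open>Distance from the left end of the first block to coordinate
    \<open>i\<close>.\<close>
  define s where "s = nat (i - p * int l)"
  have s: "int s = i - p * int l"
    using \<open>0 < l\<close> by (simp add: s_def p_def minus_div_mult_eq_mod)
  have "p \<le> q" using assms by (simp add: p_def q_def zdiv_mono1)
  have j: "j < (q + 1) * int l"
  proof -
    have "j = q * int l + j mod int l" by (simp add: q_def)
    moreover have "j mod int l < int l" using \<open>0 < l\<close> by simp
    ultimately show ?thesis by (simp add: distrib_right)
  qed
  let ?W = "extend \<sigma> (map y [p..q])"
  have lW: "length ?W = nat (q - p + 1) * l"
    using len by (subst length_extend[where l=l]) auto
  have "map (act \<sigma> y) [i..j] = take (nat (j - i + 1)) (drop s ?W)"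
  proof (rule nth_equalityI)
    have "nat (j - i + 1) \<le> length ?W - s"
    proof -
      have "int (length ?W) = (q + 1) * int l - p * int l"
        using \<open>p \<le> q\<close> by (simp add: lW algebra_simps)
      then show ?thesis using j s \<open>i \<le> j\<close> by linarith
    qed
    then show "length (map (act \<sigma> y) [i..j]) = length (take (nat (j - i + 1)) (drop s ?W))"
      by (simp add: min_def)
  next
    fix t assume "t < length (map (act \<sigma> y) [i..j])"
    then have t: "t < nat (j - i + 1)" by simp
    have "int (s + t) < int (nat (q - p + 1) * l)"
      using t j s \<open>p \<le> q\<close> by (simp add: algebra_simps)
    then have st: "s + t < nat (q - p + 1) * l" by (simp only: of_nat_less_iff)
    have e: "i + int t = int (s + t) + p * int l" using s by simp
    have d: "(i + int t) div int l = p + int ((s + t) div l)"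
      "(i + int t) mod int l = int ((s + t) mod l)"
      using \<open>0 < l\<close> unfolding e by (simp_all add: zdiv_int zmod_int)
    have k: "(s + t) div l < nat (q - p + 1)"
      using st by (simp add: less_mult_imp_div_less)
    have "take (nat (j - i + 1)) (drop s ?W) ! t = ?W ! (s + t)"
      using t st lW by simp
    also have "\<dots> = \<sigma> (map y [p..q] ! ((s + t) div l)) ! ((s + t) mod l)"
      using len \<open>0 < l\<close> st by (intro nth_extend) auto
    also have "map y [p..q] ! ((s + t) div l) = y (p + int ((s + t) div l))"
      using k by (subst nth_map) (auto simp: nth_upto)
    also have "\<sigma> \<dots> ! ((s + t) mod l) = act \<sigma> y (i + int t)"
      using len \<open>0 < l\<close> by (simp add: act_nth[where l=l] d del: of_nat_add)
    finally show "map (act \<sigma> y) [i..j] ! t = take (nat (j - i + 1)) (drop s ?W) ! t"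
      using t by (simp add: nth_upto)
  qed
  then show ?thesis
    unfolding p_def[symmetric] q_def[symmetric]
    using sublist_order.order.trans[OF sublist_take sublist_drop] by simp
qed

section \<open>Closed and measurable sets of sequences\<close>

abbreviation discrete_product :: "('i \<Rightarrow> 'b set) \<Rightarrow> ('i \<Rightarrow> 'b) topology" where
  "discrete_product B \<equiv> product_topology (\<lambda>i. discrete_topology (B i)) UNIV"

lemma PiE_UNIV: "Pi\<^sub>E UNIV V = {x. \<forall>i. x i \<in> V i}"
  by (simp add: PiE_UNIV_domain Pi_def)

lemma topspace_discrete_product: "topspace (discrete_product B) = {x. \<forall>i. x i \<in> B i}"
  by (simp add: PiE_UNIV)

text \<open>Singletons are open in a discrete factor, so fixing finitely many coordinates gives a
  basis of neighbourhoods. Topological claims become statements about finite windows.\<close>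

lemma openin_discrete_product:
  "openin (discrete_product B) U \<longleftrightarrow>
     U \<subseteq> {x. \<forall>i. x i \<in> B i} \<and>
     (\<forall>x\<in>U. \<exists>F. finite F \<and> {y. (\<forall>i. y i \<in> B i) \<and> (\<forall>i\<in>F. y i = x i)} \<subseteq> U)"
    (is "_ \<longleftrightarrow> ?R")
proof
  assume U: "openin (discrete_product B) U"
  then have "U \<subseteq> {x. \<forall>i. x i \<in> B i}"
    using openin_subset topspace_discrete_product by metis
  moreover have "\<exists>F. finite F \<and> {y. (\<forall>i. y i \<in> B i) \<and> (\<forall>i\<in>F. y i = x i)} \<subseteq> U"
    if xU: "x \<in> U" for x
  proof -
    obtain V where V: "finite {i. V i \<noteq> B i}" "x \<in> Pi\<^sub>E UNIV V" "Pi\<^sub>E UNIV V \<subseteq> U"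
      using U[unfolded openin_product_topology_alt, rule_format, OF xU] by auto
    have "{y. (\<forall>i. y i \<in> B i) \<and> (\<forall>i\<in>{i. V i \<noteq> B i}. y i = x i)} \<subseteq> Pi\<^sub>E UNIV V"
      unfolding PiE_UNIV
    proof clarify
      fix y i assume "\<forall>i. y i \<in> B i" "\<forall>i\<in>{i. V i \<noteq> B i}. y i = x i"
      then show "y i \<in> V i" using V(2) by (cases "V i = B i") (auto simp: PiE_UNIV)
    qed
    then show ?thesis
      using V(1,3) by (intro exI[of _ "{i. V i \<noteq> B i}"]) auto
  qed
  ultimately show ?R by blast
next
  assume R: ?R
  have "\<exists>V. finite {i. V i \<noteq> B i} \<and> (\<forall>i. V i \<subseteq> B i) \<and> x \<in> Pi\<^sub>E UNIV V \<and> Pi\<^sub>E UNIV V \<subseteq> U"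
    if xU: "x \<in> U" for x
  proof -
    obtain F where F: "finite F" "{y. (\<forall>i. y i \<in> B i) \<and> (\<forall>i\<in>F. y i = x i)} \<subseteq> U"
      using bspec[OF R[THEN conjunct2] xU] by auto
    have xB: "\<forall>i. x i \<in> B i" using R[THEN conjunct1] xU by auto
    let ?V = "\<lambda>i. if i \<in> F then {x i} else B i"
    have "finite {i. ?V i \<noteq> B i}" by (rule finite_subset[OF _ F(1)]) auto
    moreover have "Pi\<^sub>E UNIV ?V \<subseteq> {y. (\<forall>i. y i \<in> B i) \<and> (\<forall>i\<in>F. y i = x i)}"
      unfolding PiE_UNIV
    proof clarify
      fix y assume y: "\<forall>i. y i \<in> ?V i"
      have "y i \<in> B i" "i \<in> F \<longrightarrow> y i = x i" for i using y[rule_format, of i] xB by (auto split: if_splits)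
      then show "(\<forall>i. y i \<in> B i) \<and> (\<forall>i\<in>F. y i = x i)" by blast
    qed
    ultimately show ?thesis
      using F(2) xB by (intro exI[of _ ?V]) (auto simp: PiE_UNIV)
  qed
  then show "openin (discrete_product B) U"
    by (auto simp: openin_product_topology_alt)
qed

lemma closedin_discrete_product:
  assumes "C \<subseteq> {x. \<forall>i. x i \<in> B i}"
    and "\<And>x. \<forall>i. x i \<in> B i \<Longrightarrow> x \<notin> C \<Longrightarrow>
           \<exists>F. finite F \<and> (\<forall>y. (\<forall>i. y i \<in> B i) \<longrightarrow> (\<forall>i\<in>F. y i = x i) \<longrightarrow> y \<notin> C)"
  shows "closedin (discrete_product B) C"
  unfolding closedin_def topspace_discrete_product openin_discrete_product
proof (intro conjI ballI)
  fix x assume "x \<in> {x. \<forall>i. x i \<in> B i} - C"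
  then obtain F where "finite F" "\<forall>y. (\<forall>i. y i \<in> B i) \<longrightarrow> (\<forall>i\<in>F. y i = x i) \<longrightarrow> y \<notin> C"
    using assms(2)[of x] by auto
  then show "\<exists>F. finite F \<and> {y. (\<forall>i. y i \<in> B i) \<and> (\<forall>i\<in>F. y i = x i)}
      \<subseteq> {x. \<forall>i. x i \<in> B i} - C"
    by (intro exI[of _ F]) auto
qed (use assms(1) in auto)

text \<open>Continuity into a product is tested coordinatewise, and into a discrete factor it is
  local constancy.\<close>

lemma continuous_map_discrete_product:
  assumes "\<And>x i. \<forall>j. x j \<in> B j \<Longrightarrow> f x i \<in> C i"
    and "\<And>x i. \<forall>j. x j \<in> B j \<Longrightarrow>
           \<exists>F. finite F \<and> (\<forall>y. (\<forall>j. y j \<in> B j) \<longrightarrow> (\<forall>j\<in>F. y j = x j) \<longrightarrow> f y i = f x i)"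
  shows "continuous_map (discrete_product B) (discrete_product C) f"
proof -
  have "openin (discrete_product B) {x. (\<forall>j. x j \<in> B j) \<and> f x i \<in> V}" for i V
    unfolding openin_discrete_product
  proof (intro conjI ballI)
    fix x assume x: "x \<in> {x. (\<forall>j. x j \<in> B j) \<and> f x i \<in> V}"
    then obtain F where "finite F"
      and F: "\<forall>y. (\<forall>j. y j \<in> B j) \<longrightarrow> (\<forall>j\<in>F. y j = x j) \<longrightarrow> f y i = f x i"
      using assms(2)[of x i] by auto
    have "{y. (\<forall>i. y i \<in> B i) \<and> (\<forall>i\<in>F. y i = x i)}
        \<subseteq> {x. (\<forall>j. x j \<in> B j) \<and> f x i \<in> V}"
    proof (rule subsetI)
      fix y assume "y \<in> {y. (\<forall>i. y i \<in> B i) \<and> (\<forall>i\<in>F. y i = x i)}"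
      then have "\<forall>i. y i \<in> B i" "f y i = f x i" using F[rule_format, of y] by simp_all
      then show "y \<in> {x. (\<forall>j. x j \<in> B j) \<and> f x i \<in> V}" using x by simp
    qed
    with \<open>finite F\<close> show "\<exists>F. finite F \<and> {y. (\<forall>i. y i \<in> B i) \<and> (\<forall>i\<in>F. y i = x i)}
        \<subseteq> {x. (\<forall>j. x j \<in> B j) \<and> f x i \<in> V}"
      by - (rule exI[of _ F], rule conjI)
  qed auto
  then show ?thesis
    using assms(1)
    unfolding continuous_map_componentwise_UNIV
    unfolding continuous_map topspace_discrete_product by auto
qed

lemma compact_space_discrete_product: "(\<And>i. finite (B i)) \<Longrightarrow> compact_space (discrete_product B)"
  by (simp add: compact_space_product_topology compact_space_discrete_topology)

lemma Hausdorff_space_discrete_product: "Hausdorff_space (discrete_product B)"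
  by (simp add: Hausdorff_space_product_topology)

section \<open>Borel sets of products of discrete spaces\<close>

lemma space_borel_measure_space [simp]: "space (borel_measure_space X) = topspace X"
  unfolding borel_measure_space_def by (rule space_measure_of) (auto dest: openin_subset)

lemma sets_borel_measure_space:
  "sets (borel_measure_space X) = sigma_sets (topspace X) {U. openin X U}"
  unfolding borel_measure_space_def by (rule sets_measure_of) (auto dest: openin_subset)

lemma closedin_sets_borel: "closedin X C \<Longrightarrow> C \<in> sets (borel_measure_space X)"
proof -
  assume C: "closedin X C"
  then have "topspace X - (topspace X - C) \<in> sets (borel_measure_space X)"
    unfolding sets_borel_measure_space
    by (intro sigma_sets.Compl sigma_sets.Basic) (auto simp: closedin_def)
  moreover have "topspace X - (topspace X - C) = C"
    using closedin_subset[OF C] by auto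
  ultimately show ?thesis by simp
qed

lemma coordinate_sets_borel:
  assumes Y: "Y \<subseteq> {x. \<forall>i. x i \<in> B i}"
  shows "{x \<in> Y. x i = b} \<in> sets (borel_measure_space (subtopology (discrete_product B) Y))"
proof -
  have "openin (discrete_product B) {x. (\<forall>j. x j \<in> B j) \<and> x i = b}"
    unfolding openin_discrete_product by (auto intro!: exI[of _ "{i}"])
  moreover have "{x \<in> Y. x i = b} = {x. (\<forall>j. x j \<in> B j) \<and> x i = b} \<inter> Y"
    using Y by auto
  ultimately have "openin (subtopology (discrete_product B) Y) {x \<in> Y. x i = b}"
    by (auto simp: openin_subtopology)
  then show ?thesis by (simp add: sets_borel_measure_space sigma_sets.Basic)
qed

text \<open>With countably many coordinates and countable alphabets every open set is a countable
  union of cylinders, so coordinate events decide Borel measurability.\<close>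

lemma measurable_discrete_product:
  fixes B :: "'i :: countable \<Rightarrow> 'b set"
  assumes countable: "\<And>i. countable (B i)" and Y: "Y \<subseteq> {x. \<forall>i. x i \<in> B i}"
    and f: "\<And>\<omega>. \<omega> \<in> space M \<Longrightarrow> f \<omega> \<in> Y"
    and coord: "\<And>i b. b \<in> B i \<Longrightarrow> {\<omega> \<in> space M. f \<omega> i = b} \<in> sets M"
  shows "f \<in> measurable M (borel_measure_space (subtopology (discrete_product B) Y))"
proof -
  have top: "topspace (subtopology (discrete_product B) Y) = Y"
    using Y unfolding topspace_subtopology topspace_discrete_product by blast
  \<comment> \<open>Cylinders are coded by lists of coordinate-value pairs, so that their
    countability is that of the lists over a countable set.\<close>
  define cyl where "cyl ps = {x \<in> Y. \<forall>(i, b)\<in>set ps. x i = b}" for ps :: "('i \<times> 'b) list"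
  have cyl: "f -` cyl ps \<inter> space M \<in> sets M" if "ps \<in> lists (SIGMA i:UNIV. B i)" for ps
    using that
  proof (induction ps)
    case Nil
    have "f -` cyl [] \<inter> space M = space M" using f by (auto simp: cyl_def)
    then show ?case by simp
  next
    case (Cons p ps)
    obtain i b where p: "p = (i, b)" by force
    have "f -` cyl (p # ps) \<inter> space M = {\<omega> \<in> space M. f \<omega> i = b} \<inter> (f -` cyl ps \<inter> space M)"
      by (auto simp: cyl_def p)
    then show ?case using Cons coord by (auto simp: p)
  qed
  show ?thesis
    unfolding borel_measure_space_def
  proof (rule measurable_measure_of)
    show "f \<in> space M \<rightarrow> topspace (subtopology (discrete_product B) Y)"
      unfolding top using f by auto
  next
    fix U assume "U \<in> {U. openin (subtopology (discrete_product B) Y) U}"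
    then obtain V where V: "openin (discrete_product B) V" "U = V \<inter> Y"
      by (auto simp: openin_subtopology)
    let ?P = "{ps \<in> lists (SIGMA i:UNIV. B i). cyl ps \<subseteq> U}"
    have "x \<in> (\<Union>ps\<in>?P. cyl ps)" if xU: "x \<in> U" for x
    proof -
      have x: "x \<in> V" "x \<in> Y" "\<forall>i. x i \<in> B i" using xU V Y by auto
      then obtain F where F: "finite F" "{y. (\<forall>i. y i \<in> B i) \<and> (\<forall>i\<in>F. y i = x i)} \<subseteq> V"
        using bspec[OF V(1)[unfolded openin_discrete_product, THEN conjunct2] x(1)]
        by auto
      obtain js where js: "set js = F" using finite_list F(1) by blast
      let ?ps = "map (\<lambda>i. (i, x i)) js"
      have "cyl ?ps \<subseteq> U" using F(2) Y unfolding V(2) by (auto simp: cyl_def js)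
      moreover have "?ps \<in> lists (SIGMA i:UNIV. B i)" using x by auto
      moreover have "x \<in> cyl ?ps" using x by (auto simp: cyl_def)
      ultimately show ?thesis by blast
    qed
    then have "U = (\<Union>ps\<in>?P. cyl ps)" by auto
    then have "f -` U \<inter> space M = f -` (\<Union>ps\<in>?P. cyl ps) \<inter> space M" by (rule arg_cong)
    also have "\<dots> = (\<Union>ps\<in>?P. f -` cyl ps \<inter> space M)" by blast
    finally have "f -` U \<inter> space M = (\<Union>ps\<in>?P. f -` cyl ps \<inter> space M)" .
    moreover have "countable ?P"
      by (rule countable_subset[of _ "lists (SIGMA i:UNIV. B i)"]) (auto intro: countable)
    ultimately show "f -` U \<inter> space M \<in> sets M"
      using cyl by (simp only:) (rule sets.countable_UN', blast+)
  qed (use openin_subset[of "subtopology (discrete_product B) Y"] in blast)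
qed

section \<open>Towers of a directive sequence\<close>

locale constant_length_directive =
  fixes A :: "nat \<Rightarrow> 'a set" and \<tau> :: "nat \<Rightarrow> 'a \<Rightarrow> 'a list"
  assumes directive: "directive_sequence A \<tau>"
    and const_len: "constant_length_sequence A \<tau>"
begin

abbreviation len :: "nat \<Rightarrow> nat \<Rightarrow> nat" where
  "len n N \<equiv> morphism_length (A N) (seg \<tau> n N)"

abbreviation height :: "nat \<Rightarrow> nat" where
  "height \<equiv> tower_height A \<tau>"

abbreviation X :: "(int \<Rightarrow> 'a) set" where
  "X \<equiv> subshift A \<tau> 0"

lemma finite_alphabet: "finite (A n)" and alphabet_nonempty: "A n \<noteq> {}"
  using directive by (auto simp: directive_sequence_def)

lemma set_subst: "a \<in> A (Suc n) \<Longrightarrow> set (\<tau> n a) \<subseteq> A n"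
  and subst_nonempty: "a \<in> A (Suc n) \<Longrightarrow> \<tau> n a \<noteq> []"
  using directive by (auto simp: directive_sequence_def)

lemma seg_self: "seg \<tau> n n = (\<lambda>a. [a])"
  by (cases n) auto

lemma seg_seg: "m \<le> n \<Longrightarrow> n \<le> N \<Longrightarrow> seg \<tau> m N = (\<lambda>a. extend (seg \<tau> m n) (seg \<tau> n N a))"
proof (induction N)
  case 0
  then show ?case by simp
next
  case (Suc N)
  show ?case
  proof (cases "n = Suc N")
    case True
    then show ?thesis using seg_self[of "Suc N"] by (simp del: seg.simps)
  next
    case False
    with Suc show ?thesis by (auto simp: extend_extend)
  qed
qed

lemma set_seg: "n \<le> N \<Longrightarrow> a \<in> A N \<Longrightarrow> set (seg \<tau> n N a) \<subseteq> A n"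
proof (induction N arbitrary: a)
  case 0
  then show ?case by simp
next
  case (Suc N)
  show ?case
  proof (cases "n = Suc N")
    case True
    then show ?thesis using Suc.prems seg_self[of "Suc N"] by simp
  next
    case False
    then have "n \<le> N" using Suc.prems by simp
    then have "set (seg \<tau> n (Suc N) a) = (\<Union>b\<in>set (\<tau> N a). set (seg \<tau> n N b))"
      by (simp add: set_extend)
    then show ?thesis
      using Suc.IH[OF \<open>n \<le> N\<close>] set_subst[OF Suc.prems(2)] by blast
  qed
qed

text \<open>Lengths multiply under composition, and a nonerasing morphism on a nonempty alphabet has
  positive length.\<close>

lemma constant_length_seg: "n \<le> N \<Longrightarrow> \<exists>l>0. \<forall>a\<in>A N. length (seg \<tau> n N a) = l"
proof (induction N)
  case 0
  then show ?case by auto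
next
  case (Suc N)
  show ?case
  proof (cases "n = Suc N")
    case True
    then show ?thesis using seg_self[of "Suc N"] by auto
  next
    case False
    then have "n \<le> N" using Suc.prems by simp
    then obtain l where l: "l > 0" "\<forall>a\<in>A N. length (seg \<tau> n N a) = l"
      using Suc.IH by blast
    obtain l' where l': "\<forall>a\<in>A (Suc N). length (\<tau> N a) = l'"
      using const_len by (auto simp: constant_length_sequence_def constant_length_def)
    have "l' > 0" using l' alphabet_nonempty[of "Suc N"] subst_nonempty[of _ N] by auto
    moreover have "length (seg \<tau> n (Suc N) a) = l' * l" if "a \<in> A (Suc N)" for a
      using \<open>n \<le> N\<close> l l' that set_subst[OF that]
      by (simp add: length_extend[where l=l] subset_iff)
    ultimately show ?thesis using l(1) by (intro exI[of _ "l' * l"]) auto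
  qed
qed

lemma length_seg: "n \<le> N \<Longrightarrow> a \<in> A N \<Longrightarrow> length (seg \<tau> n N a) = len n N"
  and len_pos: "n \<le> N \<Longrightarrow> 0 < len n N"
proof -
  assume "n \<le> N"
  then obtain l where l: "l > 0" "\<forall>a\<in>A N. length (seg \<tau> n N a) = l"
    using constant_length_seg by blast
  have "len n N = l"
    unfolding morphism_length_def using l(2) alphabet_nonempty[of N] by (intro the_equality) auto
  with l show "a \<in> A N \<Longrightarrow> length (seg \<tau> n N a) = len n N" "0 < len n N" by auto
qed

lemma len_mult: "m \<le> n \<Longrightarrow> n \<le> N \<Longrightarrow> len m N = len n N * len m n"
proof -
  assume mn: "m \<le> n" "n \<le> N"
  obtain a where a: "a \<in> A N" using alphabet_nonempty by blast
  have "length (seg \<tau> m N a) = length (seg \<tau> n N a) * len m n"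
    unfolding seg_seg[OF mn] using set_seg[OF mn(2) a] mn
    by (intro length_extend) (auto simp: length_seg)
  then show ?thesis using a mn by (simp add: length_seg)
qed

lemma height_eq: "height n = len 0 n"
  by (simp add: tower_height_def)

lemma height_pos: "0 < height n"
  by (simp add: height_eq len_pos)

lemma height_mult: "n \<le> N \<Longrightarrow> height N = len n N * height n"
  by (simp add: height_eq len_mult[of 0 n N])

lemma height_dvd: "m \<le> n \<Longrightarrow> height m dvd height n"
  using height_mult[of m n] by simp

lemma length_seg0: "a \<in> A n \<Longrightarrow> length (seg \<tau> 0 n a) = height n"
  by (simp add: height_eq length_seg)

lemma subshiftD: "y \<in> subshift A \<tau> n \<Longrightarrow> y i \<in> A n"
  by (auto simp: subshift_def)

lemma shift_subshift:
  assumes "y \<in> subshift A \<tau> n"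
  shows "(\<lambda>i. y (i + k)) \<in> subshift A \<tau> n"
proof -
  have "map (\<lambda>i. y (i + k)) [i..j] = map y [i + k..j + k]" for i j
    by (rule nth_equalityI) (auto simp: nth_upto algebra_simps)
  then show ?thesis using assms by (auto simp: subshift_def)
qed

text \<open>A window of the image lies in the image of a window of \<open>y\<close>. The latter
  occurs in some \<open>seg \<tau> n N a\<close>, whose image is
  \<open>seg \<tau> m N a\<close>.\<close>

lemma act_subshift:
  assumes mn: "m \<le> n" and y: "y \<in> subshift A \<tau> n"
  shows "act (seg \<tau> m n) y \<in> subshift A \<tau> m"
proof -
  have len: "length (seg \<tau> m n (y i)) = len m n" for i
    using y mn by (simp add: length_seg subshiftD)
  have pos: "0 < len m n" using mn by (rule len_pos)
  have "act (seg \<tau> m n) y i \<in> A m" for i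
  proof -
    have "nat (i mod int (len m n)) < len m n" using pos by (simp add: nat_less_iff)
    then have "act (seg \<tau> m n) y i \<in> set (seg \<tau> m n (y (i div int (len m n))))"
      using len by (subst act_nth[where l="len m n"]) (auto simp: pos)
    then show ?thesis using set_seg[OF mn subshiftD[OF y]] by blast
  qed
  moreover have "map (act (seg \<tau> m n) y) [i..j] \<in> language A \<tau> m" for i j
  proof (cases "i \<le> j")
    case True
    define p q where "p = i div int (len m n)" and "q = j div int (len m n)"
    have "map y [p..q] \<in> language A \<tau> n" using y by (auto simp: subshift_def)
    then obtain N a where N: "N > n" "a \<in> A N" "sublist (map y [p..q]) (seg \<tau> n N a)"
      by (auto simp: language_def)
    have "sublist (map (act (seg \<tau> m n) y) [i..j]) (extend (seg \<tau> m n) (map y [p..q]))"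
      unfolding p_def q_def using len pos True by (rule map_act_sublist)
    also have "sublist \<dots> (extend (seg \<tau> m n) (seg \<tau> n N a))"
      using N(3) by (rule sublist_extend)
    also have "\<dots> = seg \<tau> m N a" using seg_seg[of m n N] mn N(1) by simp
    finally show ?thesis using N mn by (auto simp: language_def intro!: exI[of _ N])
  next
    \<comment> \<open>With \<open>j < i\<close> the window is the empty word, a factor of the image
      of any letter of the next level.\<close>
    case False
    then show ?thesis
      using alphabet_nonempty[of "Suc m"] by (auto simp: language_def intro!: exI[of _ "Suc m"])
  qed
  ultimately show ?thesis by (auto simp: subshift_def)
qed

lemma level_subset: "a \<in> A n \<Longrightarrow> level A \<tau> n (a, k) \<subseteq> X"
  using act_subshift[of 0 n] shift_subshift[of _ 0]
  by (auto simp: level_def base_def funpow_shift_map)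

text \<open>Cutting and stacking: the tower over \<open>b\<close> is a stack of pieces of towers of
  order \<open>n\<close>, one for each letter of \<open>seg \<tau> n N b\<close>. Height
  \<open>k\<close> falls in the piece number \<open>k div height n\<close>, at its floor
  \<open>k mod height n\<close>.\<close>

lemma level_coarser:
  assumes nN: "n \<le> N" and b: "b \<in> A N" and k: "k < height N"
  shows "level A \<tau> N (b, k) \<subseteq> level A \<tau> n (seg \<tau> n N b ! (k div height n), k mod height n)"
proof
  fix x assume "x \<in> level A \<tau> N (b, k)"
  then obtain y where y: "y \<in> subshift A \<tau> N" "y 0 = b"
    and x: "x = (shift_map ^^ k) (act (seg \<tau> 0 N) y)"
    by (auto simp: level_def base_def)
  define q where "q = k div height n"
  define z where "z = act (seg \<tau> n N) y"
  have z: "z \<in> subshift A \<tau> n" using act_subshift[OF nN y(1)] by (simp add: z_def)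
  have "act (seg \<tau> 0 N) y = act (seg \<tau> 0 n) z"
    unfolding z_def seg_seg[OF le0 nN] using nN y(1) subshiftD[OF y(1)]
    by (intro act_act[symmetric, where B="A n" and k="height n" and l="len n N"])
       (auto simp: length_seg0 length_seg[OF nN] height_pos len_pos dest: set_seg[OF nN, THEN subsetD])
  \<comment> \<open>Climbing \<open>q\<close> whole pieces is absorbed into a shift of
    \<open>z\<close>; only the remainder is left to climb.\<close>
  moreover have "k = k mod height n + height n * q" by (simp add: q_def)
  ultimately have "x = (shift_map ^^ (k mod height n)) ((shift_map ^^ (height n * q)) (act (seg \<tau> 0 n) z))"
    unfolding x by (metis funpow_add o_apply)
  also have "(shift_map ^^ (height n * q)) (act (seg \<tau> 0 n) z) = act (seg \<tau> 0 n) ((shift_map ^^ q) z)"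
    using z by (intro funpow_shift_map_act) (auto simp: length_seg0 height_pos subshiftD)
  finally have x': "x = (shift_map ^^ (k mod height n)) (act (seg \<tau> 0 n) ((shift_map ^^ q) z))" .
  have q: "q < len n N"
    using k height_pos[of n] by (simp add: q_def height_mult[OF nN] less_mult_imp_div_less)
  have "((shift_map ^^ q) z) 0 = z (int q)" by (simp add: funpow_shift_map)
  also have "\<dots> = seg \<tau> n N (y (int q div int (len n N))) ! nat (int q mod int (len n N))"
    unfolding z_def using nN y(1) by (intro act_nth) (auto simp: length_seg subshiftD len_pos)
  also have "\<dots> = seg \<tau> n N b ! q" using q y(2) by simp
  finally have "((shift_map ^^ q) z) 0 = seg \<tau> n N b ! q" .
  moreover have "(shift_map ^^ q) z \<in> subshift A \<tau> n"
    using shift_subshift[OF z] by (simp add: funpow_shift_map)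
  ultimately show "x \<in> level A \<tau> n (seg \<tau> n N b ! (k div height n), k mod height n)"
    unfolding x' level_def base_def q_def by auto
qed

lemma closedin_subshift: "closedin (discrete_product (\<lambda>_. A n)) (subshift A \<tau> n)"
proof (rule closedin_discrete_product)
  fix x assume "\<forall>i::int. x i \<in> A n" "x \<notin> subshift A \<tau> n"
  then obtain i j where ij: "map x [i..j] \<notin> language A \<tau> n"
    by (auto simp: subshift_def)
  have "y \<notin> subshift A \<tau> n" if "\<forall>l\<in>{i..j}. y l = x l" for y
  proof -
    have "map y [i..j] = map x [i..j]" using that by auto
    then show ?thesis using ij unfolding subshift_def by (metis (mono_tags, lifting) mem_Collect_eq)
  qed
  then show "\<exists>F. finite F \<and> (\<forall>y. (\<forall>i. y i \<in> A n) \<longrightarrow> (\<forall>i\<in>F. y i = x i) \<longrightarrow> y \<notin> subshift A \<tau> n)"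
    by (intro exI[of _ "{i..j}"]) auto
qed (auto simp: subshift_def)

text \<open>A floor is the continuous image of a compact cylinder, hence compact, hence closed in a
  Hausdorff space. The measurability of towers and of the fibres of \<open>pi_meq\<close> comes from
  here.\<close>

lemma closedin_level:
  assumes "a \<in> A n"
  shows "closedin (discrete_product (\<lambda>_. A 0)) (level A \<tau> n (a, k))"
proof -
  let ?P = "\<lambda>n. discrete_product (\<lambda>_::int. A n)"
  have "openin (?P n) {y. (\<forall>i. y i \<in> A n) \<and> y 0 \<noteq> a}"
    unfolding openin_discrete_product by (auto intro!: exI[of _ "{0}"])
  moreover have "{y \<in> subshift A \<tau> n. y 0 = a} =
      subshift A \<tau> n - {y. (\<forall>i. y i \<in> A n) \<and> y 0 \<noteq> a}"
    by (auto simp: subshiftD)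
  ultimately have "closedin (?P n) {y \<in> subshift A \<tau> n. y 0 = a}"
    using closedin_diff[OF closedin_subshift[of n]] by simp
  then have "compactin (?P n) {y \<in> subshift A \<tau> n. y 0 = a}"
    by (intro closedin_compact_space compact_space_discrete_product finite_alphabet)
  moreover have "continuous_map (?P n) (?P 0) (\<lambda>y. (shift_map ^^ k) (act (seg \<tau> 0 n) y))"
  proof (rule continuous_map_discrete_product)
    fix y :: "int \<Rightarrow> 'a" and i :: int
    assume y: "\<forall>j. y j \<in> A n"
    have act: "(shift_map ^^ k) (act (seg \<tau> 0 n) z) i =
        seg \<tau> 0 n (z ((i + int k) div int (height n))) ! nat ((i + int k) mod int (height n))"
      if "\<forall>j. z j \<in> A n" for z
      unfolding funpow_shift_map using that by (intro act_nth) (auto simp: length_seg0 height_pos)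
    show "(shift_map ^^ k) (act (seg \<tau> 0 n) y) i \<in> A 0"
    proof -
      let ?a = "y ((i + int k) div int (height n))"
      have "nat ((i + int k) mod int (height n)) < length (seg \<tau> 0 n ?a)"
        using y height_pos[of n] by (simp add: length_seg0 nat_less_iff)
      then show ?thesis
        unfolding act[OF y] using set_seg[of 0 n ?a] y nth_mem by blast
    qed
    \<comment> \<open>A single coordinate suffices: the letter of \<open>y\<close> whose block
      covers position \<open>i + k\<close>.\<close>
    show "\<exists>F. finite F \<and> (\<forall>z. (\<forall>j. z j \<in> A n) \<longrightarrow> (\<forall>j\<in>F. z j = y j) \<longrightarrow>
        (shift_map ^^ k) (act (seg \<tau> 0 n) z) i = (shift_map ^^ k) (act (seg \<tau> 0 n) y) i)"
      by (rule exI[of _ "{(i + int k) div int (height n)}"]) (auto simp: act y)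
  qed
  ultimately have "compactin (?P 0)
      ((\<lambda>y. (shift_map ^^ k) (act (seg \<tau> 0 n) y)) ` {y \<in> subshift A \<tau> n. y 0 = a})"
    by (rule image_compactin)
  also have "(\<lambda>y. (shift_map ^^ k) (act (seg \<tau> 0 n) y)) ` {y \<in> subshift A \<tau> n. y 0 = a} =
      level A \<tau> n (a, k)"
    by (auto simp: level_def base_def)
  finally show ?thesis
    using Hausdorff_space_discrete_product by (rule compactin_imp_closedin[rotated])
qed

lemma topspace_subshift_topology: "topspace (subshift_topology A \<tau>) = X"
  unfolding subshift_topology_def topspace_subtopology topspace_discrete_product
  by (auto simp: subshiftD)

lemma level_sets:
  assumes "a \<in> A n"
  shows "level A \<tau> n (a, k) \<in> sets (borel_measure_space (subshift_topology A \<tau>))"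
proof (rule closedin_sets_borel)
  have "level A \<tau> n (a, k) = level A \<tau> n (a, k) \<inter> X" using level_subset[OF assms] by blast
  then show "closedin (subshift_topology A \<tau>) (level A \<tau> n (a, k))"
    unfolding subshift_topology_def closedin_subtopology using closedin_level[OF assms] by blast
qed

end

section \<open>Recognizability and the map to the odometer\<close>

locale recognizable_directive = constant_length_directive +
  assumes recog: "recognizable A \<tau>"
begin

lemma levels_cover:
  assumes "x \<in> X"
  obtains a k where "a \<in> A n" "k < height n" "x \<in> level A \<tau> n (a, k)"
  using recog assms length_seg0 unfolding recognizable_def level_indices_def by force

lemma levels_disjoint:
  assumes "x \<in> level A \<tau> n (a, k)" "x \<in> level A \<tau> n (b, j)"
    and "a \<in> A n" "k < height n" "b \<in> A n" "j < height n"
  shows "a = b" "k = j"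
proof -
  have "disjoint_family_on (level A \<tau> n) (level_indices A \<tau> n)"
    using recog by (auto simp: recognizable_def)
  moreover have "(a, k) \<in> level_indices A \<tau> n" "(b, j) \<in> level_indices A \<tau> n"
    using assms by (auto simp: level_indices_def length_seg0)
  ultimately have "(a, k) = (b, j)"
    using assms(1,2) unfolding disjoint_family_on_def by blast
  then show "a = b" "k = j" by auto
qed

text \<open>Disjointness of the floors gives the uniqueness that the definite description in
  \<open>pi_meq\<close> asks for.\<close>

lemma pi_meq_eq:
  assumes "x \<in> level A \<tau> n (a, k)" "a \<in> A n" "k < height n"
  shows "pi_meq A \<tau> x n = k"
  unfolding pi_meq_def
proof (rule the_equality)
  show "k < height n \<and> x \<in> (shift_map ^^ k) ` total_base A \<tau> n"
    using assms by (auto simp: level_def total_base_def)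
  fix j assume j: "j < height n \<and> x \<in> (shift_map ^^ j) ` total_base A \<tau> n"
  then obtain b where "b \<in> A n" "x \<in> level A \<tau> n (b, j)"
    by (auto simp: level_def total_base_def)
  then show "j = k" using levels_disjoint(2)[OF assms(1)] assms j by auto
qed

lemma pi_meq_less: "x \<in> X \<Longrightarrow> pi_meq A \<tau> x n < height n"
  by (metis levels_cover pi_meq_eq)

lemma pi_meq_level:
  assumes "x \<in> X"
  obtains a where "a \<in> A n" "x \<in> level A \<tau> n (a, pi_meq A \<tau> x n)"
  using assms by (metis levels_cover pi_meq_eq)

lemma pi_meq_fibre:
  assumes "k < height n"
  shows "{x \<in> X. pi_meq A \<tau> x n = k} = (\<Union>a\<in>A n. level A \<tau> n (a, k))"
proof (intro equalityI subsetI)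
  fix x assume "x \<in> (\<Union>a\<in>A n. level A \<tau> n (a, k))"
  then show "x \<in> {x \<in> X. pi_meq A \<tau> x n = k}"
    using level_subset pi_meq_eq assms by blast
qed (auto elim: pi_meq_level)

text \<open>Compatibility of the residues is \<open>level_coarser\<close>: a point on floor
  \<open>k\<close> at level \<open>n\<close> lies on floor \<open>k mod height m\<close> at level
  \<open>m\<close>.\<close>

lemma pi_meq_odometer:
  assumes x: "x \<in> X"
  shows "pi_meq A \<tau> x \<in> odometer height"
  unfolding odometer_def
proof (intro CollectI conjI allI impI pi_meq_less[OF x])
  fix m n :: nat assume mn: "m \<le> n"
  obtain b where b: "b \<in> A n" "x \<in> level A \<tau> n (b, pi_meq A \<tau> x n)"
    using x by (rule pi_meq_level)
  let ?k = "pi_meq A \<tau> x n"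
  have k: "?k < height n" using x by (rule pi_meq_less)
  have "?k div height m < len m n"
    using k by (simp add: height_mult[OF mn] less_mult_imp_div_less)
  then have "seg \<tau> m n b ! (?k div height m) \<in> A m"
    using set_seg[OF mn b(1)] length_seg[OF mn b(1)] nth_mem by (metis subsetD)
  moreover have "x \<in> level A \<tau> m (seg \<tau> m n b ! (?k div height m), ?k mod height m)"
    using level_coarser[OF mn b(1) k] b(2) by blast
  ultimately show "?k mod height m = pi_meq A \<tau> x m"
    using pi_meq_eq height_pos by (metis mod_less_divisor)
qed

lemma shift_map_X: "x \<in> X \<Longrightarrow> shift_map x \<in> X"
  using shift_subshift[of x 0 1] by (simp add: shift_map_def)

lemma pi_meq_shift:
  assumes x: "x \<in> X"
  shows "pi_meq A \<tau> (shift_map x) = odometer_succ height (pi_meq A \<tau> x)"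
proof
  fix n
  obtain a where a: "a \<in> A n" "x \<in> level A \<tau> n (a, pi_meq A \<tau> x n)"
    using x by (rule pi_meq_level)
  let ?k = "pi_meq A \<tau> x n"
  have k: "?k < height n" using x by (rule pi_meq_less)
  obtain y where y: "y \<in> subshift A \<tau> n" "y 0 = a"
    and xy: "x = (shift_map ^^ ?k) (act (seg \<tau> 0 n) y)"
    using a by (auto simp: level_def base_def)
  have Sx: "shift_map x = (shift_map ^^ Suc ?k) (act (seg \<tau> 0 n) y)"
    by (subst xy) simp
  show "pi_meq A \<tau> (shift_map x) n = odometer_succ height (pi_meq A \<tau> x) n"
  proof (cases "Suc ?k < height n")
    case True
    have "shift_map x \<in> level A \<tau> n (a, Suc ?k)"
      unfolding Sx level_def base_def using y by blast
    then show ?thesis using pi_meq_eq[OF _ a(1) True] True by (simp add: odometer_succ_def)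
  next
    \<comment> \<open>From the top floor the shift completes one whole block and returns to the base
      over the next letter \<open>y 1\<close>; this is the wrap-around of
      \<open>odometer_succ\<close> to 0.\<close>
    case False
    then have h: "Suc ?k = height n * 1" using k by simp
    have "shift_map x = act (seg \<tau> 0 n) ((shift_map ^^ 1) y)"
      unfolding Sx h using y(1)
      by (intro funpow_shift_map_act) (auto simp: length_seg0 height_pos subshiftD)
    moreover have "(shift_map ^^ 1) y \<in> subshift A \<tau> n"
      using shift_subshift[OF y(1), of 1] by (simp add: shift_map_def)
    ultimately have "shift_map x \<in> level A \<tau> n (y 1, 0)"
      unfolding level_def base_def by (auto simp: shift_map_def)
    then have "pi_meq A \<tau> (shift_map x) n = 0"
      using subshiftD[OF y(1)] height_pos by (intro pi_meq_eq) auto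
    then show ?thesis using h by (simp add: odometer_succ_def)
  qed
qed

text \<open>Links towers to words. Since the words of two towers agree at a coincidence, there the
  height alone gives the letter.\<close>

lemma level_letter:
  assumes "x \<in> level A \<tau> n (a, k)" "a \<in> A n" "k < height n"
  shows "x 0 = seg \<tau> 0 n a ! k"
proof -
  obtain y where y: "y \<in> subshift A \<tau> n" "y 0 = a" "x = (shift_map ^^ k) (act (seg \<tau> 0 n) y)"
    using assms by (auto simp: level_def base_def)
  have "x 0 = act (seg \<tau> 0 n) y (int k)" by (simp add: y(3) funpow_shift_map)
  also have "\<dots> = seg \<tau> 0 n (y (int k div int (height n))) ! nat (int k mod int (height n))"
    using y(1) by (intro act_nth) (auto simp: length_seg0 height_pos subshiftD)
  finally show ?thesis using assms(3) y(2) by simp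
qed

lemma tower_eq: "a \<in> A n \<Longrightarrow> tower A \<tau> n a = (\<Union>k<height n. level A \<tau> n (a, k))"
  by (simp add: tower_def level_def length_seg0)

end

section \<open>Odometers and their Haar measure\<close>

text \<open>The inverse translation; \<open>h\<close> is added before \<open>g\<close> is subtracted
  because the subtraction is on naturals.\<close>

lemma add_mod_eq_iff:
  fixes g z k h :: nat
  assumes "g < h" "z < h" "k < h"
  shows "(g + z) mod h = k \<longleftrightarrow> z = (k + h - g) mod h"
proof -
  have "(g + z) mod h = (if g + z < h then g + z else g + z - h)"
    using assms by (auto simp: le_mod_geq)
  moreover have "(k + h - g) mod h = (if k < g then k + h - g else k - g)"
  proof (cases "k < g")
    case False
    then have "k + h - g = k - g + h" by simp
    then have "(k + h - g) mod h = (k - g) mod h" by simp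
    then show ?thesis using False assms by simp
  qed (use assms in auto)
  ultimately show ?thesis using assms by auto
qed

lemma measure_UN_lessThan_const:
  assumes "prob_space M" and "\<And>k. k < (h::nat) \<Longrightarrow> C k \<in> sets M"
    and "disjoint_family_on C {..<h}" and "\<And>k. k < h \<Longrightarrow> measure M (C k) = c"
  shows "measure M (\<Union>k<h. C k) = real h * c"
proof -
  interpret prob_space M by fact
  have "measure M (\<Union>k<h. C k) = (\<Sum>k<h. measure M (C k))"
    using assms by (intro finite_measure_finite_Union) auto
  then show ?thesis using assms by simp
qed

locale odometer_scale =
  fixes h :: "nat \<Rightarrow> nat"
  assumes pos: "0 < h n" and dvd: "m \<le> n \<Longrightarrow> h m dvd h n"
begin

abbreviation borel_odometer :: "(nat \<Rightarrow> nat) measure" where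
  "borel_odometer \<equiv> borel_measure_space (odometer_topology h)"

definition cylinder :: "nat \<Rightarrow> nat \<Rightarrow> (nat \<Rightarrow> nat) set" where
  "cylinder n k = {z \<in> odometer h. z n = k}"

lemma odometer_subset: "odometer h \<subseteq> {z. \<forall>n. z n \<in> {..<h n}}"
  by (auto simp: odometer_def)

lemma odometer_less: "z \<in> odometer h \<Longrightarrow> z n < h n"
  by (simp add: odometer_def)

lemma topspace_odometer: "topspace (odometer_topology h) = odometer h"
  unfolding odometer_topology_def topspace_subtopology topspace_discrete_product
  using odometer_subset by blast

lemma cylinder_sets [measurable]: "cylinder n k \<in> sets borel_odometer"
  unfolding odometer_topology_def cylinder_def by (intro coordinate_sets_borel odometer_subset)

lemma measurable_odometer:
  assumes "\<And>\<omega>. \<omega> \<in> space M \<Longrightarrow> f \<omega> \<in> odometer h"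
    and "\<And>n k. k < h n \<Longrightarrow> {\<omega> \<in> space M. f \<omega> n = k} \<in> sets M"
  shows "f \<in> measurable M borel_odometer"
  unfolding odometer_topology_def
  using assms odometer_subset by (intro measurable_discrete_product) auto

text \<open>The identity from the sigma-algebra of the cylinders to the Borel one is measurable,
  which gives the less immediate inclusion. Both the comparison of measures and the induction over
  Borel sets start from this generator.\<close>

lemma sets_borel_odometer:
  "sets borel_odometer = sigma_sets (odometer h) (range (\<lambda>(n, k). cylinder n k))" (is "_ = sigma_sets _ ?C")
proof
  have C: "?C \<subseteq> Pow (odometer h)" by (auto simp: cylinder_def)
  show "sigma_sets (odometer h) ?C \<subseteq> sets borel_odometer"
    using sets.sigma_sets_subset[of ?C borel_odometer] by (simp add: topspace_odometer image_subset_iff)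
  have "(\<lambda>z. z) \<in> measurable (sigma (odometer h) ?C) borel_odometer"
  proof (rule measurable_odometer)
    fix n k
    have "cylinder n k \<in> sigma_sets (odometer h) ?C" by (rule sigma_sets.Basic) auto
    then show "{\<omega> \<in> space (sigma (odometer h) ?C). \<omega> n = k} \<in> sets (sigma (odometer h) ?C)"
      using C by (simp add: space_measure_of sets_measure_of cylinder_def)
  qed (simp add: space_measure_of[OF C])
  then have "E \<inter> odometer h \<in> sigma_sets (odometer h) ?C" if "E \<in> sets borel_odometer" for E
    using measurable_sets[of "\<lambda>z. z" "sigma (odometer h) ?C" borel_odometer E] that C
    by (simp add: space_measure_of sets_measure_of)
  moreover have "E \<inter> odometer h = E" if "E \<in> sets borel_odometer" for E
    using sets.sets_into_space[OF that] by (auto simp: topspace_odometer)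
  ultimately show "sets borel_odometer \<subseteq> sigma_sets (odometer h) ?C" by fastforce
qed

lemma cylinder_Int: "m \<le> n \<Longrightarrow> cylinder n k \<inter> cylinder m l = (if k mod h m = l then cylinder n k else {})"
  by (auto simp: cylinder_def odometer_def)

text \<open>The out-of-range residue \<open>h n\<close> presents the empty set as a cylinder, so
  that the family of cylinders is closed under intersection.\<close>

lemma cylinder_empty: "cylinder n (h n) = {}"
  using odometer_less less_irrefl unfolding cylinder_def by (metis (mono_tags, lifting) empty_Collect_eq)

text \<open>Divisibility makes any two cylinders nested or disjoint.\<close>

lemma Int_stable_cylinders: "Int_stable (range (\<lambda>(n, k). cylinder n k))"
proof (rule Int_stableI)
  fix C D assume "C \<in> range (\<lambda>(n, k). cylinder n k)" "D \<in> range (\<lambda>(n, k). cylinder n k)"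
  then obtain n k m l where CD: "C = cylinder n k" "D = cylinder m l" by auto
  have empty: "{} \<in> range (\<lambda>(n, k). cylinder n k)"
    using cylinder_empty[of 0] by (auto intro!: image_eqI[of _ _ "(0, h 0)"])
  show "C \<inter> D \<in> range (\<lambda>(n, k). cylinder n k)"
  proof (cases "m \<le> n")
    case True
    then show ?thesis using empty by (auto simp: CD cylinder_Int)
  next
    case False
    then have "C \<inter> D = (if l mod h n = k then cylinder m l else {})"
      unfolding CD using cylinder_Int[of n m l k] by (simp add: Int_commute)
    then show ?thesis using empty by auto
  qed
qed

lemma odometer_measure_eqI:
  assumes M: "borel_probability (odometer_topology h) M"
    and N: "borel_probability (odometer_topology h) N"
    and eq: "\<And>n k. k < h n \<Longrightarrow> measure M (cylinder n k) = measure N (cylinder n k)"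
  shows "M = N"
proof (rule measure_eqI_generator_eq[OF Int_stable_cylinders])
  interpret M: prob_space M using M by (simp add: borel_probability_def)
  interpret N: prob_space N using N by (simp add: borel_probability_def)
  show "range (\<lambda>(n, k). cylinder n k) \<subseteq> Pow (odometer h)" by (auto simp: cylinder_def)
  show "sets M = sigma_sets (odometer h) (range (\<lambda>(n, k). cylinder n k))"
    "sets N = sigma_sets (odometer h) (range (\<lambda>(n, k). cylinder n k))"
    using M N by (simp_all add: borel_probability_def sets_borel_odometer)
  fix C assume "C \<in> range (\<lambda>(n, k). cylinder n k)"
  then obtain n k where C: "C = cylinder n k" by auto
  have "cylinder n k = {}" if "\<not> k < h n" using that by (auto simp: cylinder_def odometer_def)
  then show "emeasure M C = emeasure N C"
    using eq[of k n] by (cases "k < h n") (auto simp: C M.emeasure_eq_measure N.emeasure_eq_measure)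
next
  interpret M: prob_space M using M by (simp add: borel_probability_def)
  show "range (cylinder 0) \<subseteq> range (\<lambda>(n, k). cylinder n k)" by auto
  show "(\<Union>i. cylinder 0 i) = odometer h" by (auto simp: cylinder_def)
  show "emeasure M (cylinder 0 i) \<noteq> \<infinity>" for i by simp
qed

lemma odometer_add_odometer:
  assumes "g \<in> odometer h" "z \<in> odometer h"
  shows "odometer_add h g z \<in> odometer h"
  unfolding odometer_def
proof (intro CollectI conjI allI impI)
  fix m n :: nat assume mn: "m \<le> n"
  have "((g n + z n) mod h n) mod h m = (g n + z n) mod h m"
    using dvd[OF mn] by (simp add: mod_mod_cancel)
  also have "\<dots> = (g n mod h m + z n mod h m) mod h m" by (simp add: mod_add_eq)
  also have "\<dots> = (g m + z m) mod h m" using assms mn by (auto simp: odometer_def)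
  finally show "odometer_add h g z n mod h m = odometer_add h g z m"
    by (simp add: odometer_add_def)
qed (simp add: odometer_add_def pos)

lemma odometer_add_vimage:
  assumes "g \<in> odometer h" "k < h n"
  shows "odometer_add h g -` cylinder n k \<inter> odometer h = cylinder n ((k + h n - g n) mod h n)"
proof -
  have "odometer_add h g z n = k \<longleftrightarrow> z n = (k + h n - g n) mod h n" if "z \<in> odometer h" for z
    unfolding odometer_add_def using assms that odometer_subset by (intro add_mod_eq_iff) auto
  then show ?thesis using odometer_add_odometer[OF assms(1)] by (auto simp: cylinder_def)
qed

lemma odometer_add_measurable:
  assumes "g \<in> odometer h" "sets M = sets borel_odometer"
  shows "odometer_add h g \<in> measurable M M"
proof -
  have sp: "space M = odometer h"
    using sets_eq_imp_space_eq[OF assms(2)] by (simp add: topspace_odometer)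
  have "odometer_add h g \<in> measurable M borel_odometer"
  proof (rule measurable_odometer)
    fix n k assume "k < h n"
    have "{z \<in> space M. odometer_add h g z n = k} = odometer_add h g -` cylinder n k \<inter> odometer h"
      using odometer_add_odometer[OF assms(1)] by (auto simp: sp cylinder_def)
    then show "{z \<in> space M. odometer_add h g z n = k} \<in> sets M"
      using odometer_add_vimage[OF assms(1) \<open>k < h n\<close>] assms(2) by simp
  qed (simp add: sp odometer_add_odometer assms)
  then show ?thesis using assms(2) by (simp cong: measurable_cong_sets)
qed

text \<open>Translations permute the cylinders of each level, so equal masses give invariance;
  conversely invariance forces equal masses on a partition into \<open>h n\<close> cylinders. These
  are the existence and the uniqueness behind the definite description.\<close>

lemma odometer_haar_eq:
  assumes M: "borel_probability (odometer_topology h) M"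
    and cyl: "\<And>n k. k < h n \<Longrightarrow> measure M (cylinder n k) = 1 / real (h n)"
  shows "odometer_haar h = M"
  unfolding odometer_haar_def
proof (rule the_equality, intro conjI ballI M)
  interpret M: prob_space M using M by (simp add: borel_probability_def)
  have sM: "sets M = sets borel_odometer" using M by (simp add: borel_probability_def)
  have sp: "space M = odometer h"
    using sets_eq_imp_space_eq[OF sM] by (simp add: topspace_odometer)
  fix g assume g: "g \<in> odometer h"
  note meas = odometer_add_measurable[OF g sM]
  have "distr M M (odometer_add h g) = M"
  proof (rule odometer_measure_eqI[OF _ M])
    show "borel_probability (odometer_topology h) (distr M M (odometer_add h g))"
      using M.prob_space_distr[OF meas] sM by (simp add: borel_probability_def)
    fix n k assume k: "k < h n"
    have "measure (distr M M (odometer_add h g)) (cylinder n k) =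
        measure M (cylinder n ((k + h n - g n) mod h n))"
      using odometer_add_vimage[OF g k] by (simp add: measure_distr[OF meas] sM sp)
    then show "measure (distr M M (odometer_add h g)) (cylinder n k) = measure M (cylinder n k)"
      using cyl k pos[of n] by simp
  qed
  with meas show "invariant_measure (odometer_add h g) M" by (simp add: invariant_measure_def)
next
  fix N assume N': "borel_probability (odometer_topology h) N \<and>
    (\<forall>g\<in>odometer h. invariant_measure (odometer_add h g) N)"
  then have N: "borel_probability (odometer_topology h) N" by blast
  interpret N: prob_space N using N by (simp add: borel_probability_def)
  have sN: "sets N = sets borel_odometer" using N by (simp add: borel_probability_def)
  have sp: "space N = odometer h"
    using sets_eq_imp_space_eq[OF sN] by (simp add: topspace_odometer)
  have zero: "measure N (cylinder n k) = measure N (cylinder n 0)" if k: "k < h n" for n k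
  proof -
    \<comment> \<open>The integer \<open>k\<close> seen in the odometer: under translation by it the
      preimage of \<open>cylinder n k\<close> is \<open>cylinder n 0\<close>.\<close>
    define g where "g = (\<lambda>m. k mod h m)"
    have g: "g \<in> odometer h"
      using pos dvd by (auto simp: g_def odometer_def mod_mod_cancel)
    have inv: "distr N N (odometer_add h g) = N" "odometer_add h g \<in> measurable N N"
      using N' g by (auto simp: invariant_measure_def)
    have "measure N (cylinder n k) = measure (distr N N (odometer_add h g)) (cylinder n k)"
      by (simp only: inv)
    also have "\<dots> = measure N (cylinder n ((k + h n - g n) mod h n))"
      using odometer_add_vimage[OF g k] by (simp add: measure_distr[OF inv(2)] sN sp)
    finally show ?thesis using k by (simp add: g_def)
  qed
  show "N = M"
  proof (rule odometer_measure_eqI[OF N M])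
    fix n k assume k: "k < h n"
    have "(\<Union>k<h n. cylinder n k) = odometer h" by (auto simp: cylinder_def odometer_def)
    then have "1 = measure N (\<Union>k<h n. cylinder n k)" using N.prob_space sp by simp
    also have "\<dots> = real (h n) * measure N (cylinder n 0)"
    proof (rule measure_UN_lessThan_const[OF N.prob_space_axioms])
      show "disjoint_family_on (cylinder n) {..<h n}"
        by (auto simp: disjoint_family_on_def cylinder_def)
      show "cylinder n k \<in> sets N" for k using sN by simp
    qed (rule zero)
    finally show "measure N (cylinder n k) = measure M (cylinder n k)"
      unfolding zero[OF k] cyl[OF k] using pos[of n] by (simp add: eq_divide_eq mult.commute)
  qed
qed

text \<open>Sets with such approximations form a sigma-algebra containing the cylinders. All large
  \<open>N\<close> can be served because a cylinder of level \<open>n\<close> is a union of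
  cylinders of any higher level.\<close>

lemma approximation_by_cylinders:
  assumes "prob_space M" and sM: "sets M = sets borel_odometer"
    and "D \<in> sets M" and "0 < \<epsilon>"
  shows "\<exists>N0. \<forall>N\<ge>N0. \<exists>K. measure M (sym_diff D {z \<in> odometer h. z N \<in> K}) < \<epsilon>"
proof -
  interpret prob_space M by fact
  have sp: "space M = odometer h"
    using sets_eq_imp_space_eq[OF sM] by (simp add: topspace_odometer)
  define cyl where "cyl N K = {z \<in> odometer h. z N \<in> K}" for N K
  have cyl [measurable]: "cyl N K \<in> sets M" for N K
  proof -
    have "cyl N K = (\<Union>k\<in>K. cylinder N k)" by (auto simp: cyl_def cylinder_def)
    then show ?thesis using sM by auto
  qed
  define approx where "approx D \<longleftrightarrow>
    D \<in> sets M \<and> (\<forall>\<epsilon>>0. \<exists>N0. \<forall>N\<ge>N0. \<exists>K. measure M (sym_diff D (cyl N K)) < \<epsilon>)" for D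
  have union: "approx (C \<union> D)" if C: "approx C" and D: "approx D" for C D
    unfolding approx_def
  proof (intro conjI allI impI)
    show "C \<union> D \<in> sets M" using C D by (auto simp: approx_def)
    fix \<epsilon> :: real assume "0 < \<epsilon>"
    then obtain N1 N2 where N1: "\<forall>N\<ge>N1. \<exists>K. measure M (sym_diff C (cyl N K)) < \<epsilon> / 2"
      and N2: "\<forall>N\<ge>N2. \<exists>K. measure M (sym_diff D (cyl N K)) < \<epsilon> / 2"
      using C D half_gt_zero[of \<epsilon>] unfolding approx_def by blast
    have "\<exists>K. measure M (sym_diff (C \<union> D) (cyl N K)) < \<epsilon>" if N: "N \<ge> max N1 N2" for N
    proof -
      obtain K L where K: "measure M (sym_diff C (cyl N K)) < \<epsilon> / 2"
        and L: "measure M (sym_diff D (cyl N L)) < \<epsilon> / 2"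
        using N1 N2 N by (meson max.boundedE)
      have sets: "sym_diff C (cyl N K) \<in> sets M" "sym_diff D (cyl N L) \<in> sets M"
        using C D cyl by (auto simp: approx_def)
      have "measure M (sym_diff (C \<union> D) (cyl N (K \<union> L))) \<le>
          measure M (sym_diff C (cyl N K) \<union> sym_diff D (cyl N L))"
        by (rule finite_measure_mono[OF _ sets.Un[OF sets]]) (auto simp: cyl_def)
      also have "\<dots> \<le> measure M (sym_diff C (cyl N K)) + measure M (sym_diff D (cyl N L))"
        using sets by (rule measure_Un_le)
      finally show ?thesis using K L by (intro exI[of _ "K \<union> L"]) simp
    qed
    then show "\<exists>N0. \<forall>N\<ge>N0. \<exists>K. measure M (sym_diff (C \<union> D) (cyl N K)) < \<epsilon>" by blast
  qed
  have "D \<in> sigma_sets (odometer h) (range (\<lambda>(n, k). cylinder n k))"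
    using \<open>D \<in> sets M\<close> sM sets_borel_odometer by simp
  then have "approx D"
  proof induction
    case (Basic C)
    then obtain n k where C: "C = cylinder n k" by auto
    have *: "sym_diff C (cyl N {j. j mod h n = k}) = {}" if "N \<ge> n" for N
      using that by (auto simp: C cylinder_def cyl_def odometer_def)
    have "\<exists>K. measure M (sym_diff C (cyl N K)) < \<epsilon>" if "N \<ge> n" "0 < \<epsilon>" for N \<epsilon>
      using that(2) by (intro exI[of _ "{j. j mod h n = k}"]) (simp only: *[OF that(1)] measure_empty)
    then show ?case
      unfolding approx_def using sM C by auto
  next
    case Empty
    have "sym_diff {} (cyl N {}) = {}" for N by (auto simp: cyl_def)
    then show ?case unfolding approx_def by (auto intro!: exI[of _ "{}"])
  next
    case (Compl C)
    have C: "C \<subseteq> odometer h" using Compl.IH sets.sets_into_space[of C M] by (auto simp: approx_def sp)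
    have "sym_diff (odometer h - C) (cyl N (- K)) = sym_diff C (cyl N K)" for N K
      using C by (auto simp: cyl_def)
    moreover have "odometer h - C \<in> sets M"
      using Compl.IH sets.compl_sets[of C M] by (simp add: approx_def sp)
    ultimately show ?case using Compl.IH unfolding approx_def by metis
  next
    case (Union C)
    \<comment> \<open>The finite partial unions increase to the whole union. One of them misses less
      than \<open>\<epsilon> / 2\<close>, and the other half is spent on approximating it.\<close>
    define U where "U m = (\<Union>i\<le>m. C i)" for m :: nat
    have U: "approx (U m)" for m
    proof (induction m)
      case 0
      then show ?case using Union.IH[of 0] by (simp add: U_def)
    next
      case (Suc m)
      have "U (Suc m) = U m \<union> C (Suc m)" by (auto simp: U_def atMost_Suc)
      then show ?case using union[OF Suc Union.IH[of "Suc m"]] by simp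
    qed
    have [measurable]: "U m \<in> sets M" for m using U by (simp add: approx_def)
    have V: "(\<Union>m. U m) = (\<Union>i. C i)" by (auto simp: U_def)
    have [measurable]: "(\<Union>i. C i) \<in> sets M" using Union.IH by (auto simp: approx_def)
    have lim: "(\<lambda>m. measure M (U m)) \<longlonglongrightarrow> measure M (\<Union>i. C i)"
      unfolding V[symmetric]
      unfolding U_def
      by (rule finite_Lim_measure_incseq) (use \<open>\<And>m. U m \<in> sets M\<close> in \<open>auto simp: U_def atMost_Suc intro!: incseq_SucI\<close>)
    show ?case
      unfolding approx_def
    proof (intro conjI allI impI)
      fix \<epsilon> :: real assume "0 < \<epsilon>"
      obtain m where m: "measure M (\<Union>i. C i) - measure M (U m) < \<epsilon> / 2"
        using LIMSEQ_D[OF lim, of "\<epsilon> / 2"] half_gt_zero[OF \<open>0 < \<epsilon>\<close>] unfolding real_norm_def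
        by (metis abs_minus_commute abs_less_iff order_refl)
      obtain N0 where N0: "\<forall>N\<ge>N0. \<exists>K. measure M (sym_diff (U m) (cyl N K)) < \<epsilon> / 2"
        using U[of m] half_gt_zero[OF \<open>0 < \<epsilon>\<close>] unfolding approx_def by blast
      have "\<exists>K. measure M (sym_diff (\<Union>i. C i) (cyl N K)) < \<epsilon>" if N: "N \<ge> N0" for N
      proof -
        obtain K where K: "measure M (sym_diff (U m) (cyl N K)) < \<epsilon> / 2" using N0 N by blast
        have "measure M (sym_diff (\<Union>i. C i) (cyl N K)) \<le>
            measure M (((\<Union>i. C i) - U m) \<union> sym_diff (U m) (cyl N K))"
        proof (rule finite_measure_mono)
          have "U m \<subseteq> (\<Union>i. C i)" by (auto simp: U_def)
          then show "sym_diff (\<Union>i. C i) (cyl N K) \<subseteq> ((\<Union>i. C i) - U m) \<union> sym_diff (U m) (cyl N K)"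
            by blast
        qed auto
        also have "\<dots> \<le> measure M ((\<Union>i. C i) - U m) + measure M (sym_diff (U m) (cyl N K))"
          by (intro measure_Un_le) auto
        also have "measure M ((\<Union>i. C i) - U m) = measure M (\<Union>i. C i) - measure M (U m)"
          by (rule finite_measure_Diff) (measurable, auto simp: U_def)
        finally show ?thesis using K m by (intro exI[of _ K]) simp
      qed
      then show "\<exists>N0. \<forall>N\<ge>N0. \<exists>K. measure M (sym_diff (\<Union>i. C i) (cyl N K)) < \<epsilon>" by blast
    qed simp
  qed
  then show ?thesis using \<open>0 < \<epsilon>\<close> by (auto simp: approx_def cyl_def)
qed

end

section \<open>Isomorphism with the odometer\<close>

text \<open>The candidate inverse \<open>g\<close> is total, and the two sets of the isomorphism are
  where it inverts \<open>f\<close> from either side. Equivariance of \<open>f\<close> and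
  \<open>g\<close> makes them forward invariant.\<close>

lemma measure_isomorphismI:
  assumes "prob_space M" and f: "f \<in> measurable M N" and N: "distr M N f = N"
    and S: "\<And>x. x \<in> space M \<Longrightarrow> S x \<in> space M" "\<And>x. x \<in> space M \<Longrightarrow> f (S x) = T (f x)"
    and T: "\<And>z. z \<in> space N \<Longrightarrow> T z \<in> space N" "\<And>z. z \<in> space N \<Longrightarrow> g (T z) = S (g z)"
    and M0: "{x \<in> space M. g (f x) = x} \<in> sets M"
    and N0: "{z \<in> space N. g z \<in> space M \<and> f (g z) = z} \<in> sets N"
    and g: "g \<in> measurable (restrict_space N {z \<in> space N. g z \<in> space M \<and> f (g z) = z}) M"
    and ae: "AE x in M. g (f x) = x"
  shows "measure_isomorphism M S N T f"
proof -
  interpret prob_space M by fact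
  define M0 where "M0 = {x \<in> space M. g (f x) = x}"
  define N0 where "N0 = {z \<in> space N. g z \<in> space M \<and> f (g z) = z}"
  have M0s: "M0 \<in> sets M" and N0s: "N0 \<in> sets N"
    using M0 N0 by (auto simp: M0_def N0_def)
  have fsp: "f x \<in> space N" if "x \<in> space M" for x
    using f that by (rule measurable_space)
  have M01: "emeasure M M0 = 1"
    using ae M0s prob_eq_1[of M0] by (auto simp: M0_def emeasure_eq_measure elim: AE_mp)
  have bij: "bij_betw f M0 N0"
    by (rule bij_betw_byWitness[where f'=g]) (auto simp: M0_def N0_def fsp)
  have inv: "the_inv_into M0 f z = g z" if "z \<in> N0" for z
  proof -
    have "g z \<in> M0" "f (g z) = z" using that by (auto simp: M0_def N0_def)
    then show ?thesis using bij the_inv_into_f_f[of f M0 "g z"] by (simp add: bij_betw_def)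
  qed
  have f0: "f \<in> measurable (restrict_space M M0) (restrict_space N N0)"
    using bij f by (intro measurable_restrict_space2 measurable_restrict_space1) 
      (auto simp: space_restrict_space dest: bij_betwE)
  have sp: "space (restrict_space N N0) = N0" "space (restrict_space M M0) = M0"
    using M0s N0s sets.sets_into_space by (auto simp: space_restrict_space)
  have "g \<in> measurable (restrict_space N N0) (restrict_space M M0)"
  proof (rule measurable_restrict_space2)
    show "g \<in> space (restrict_space N N0) \<rightarrow> M0"
      unfolding sp by (auto simp: M0_def N0_def)
  qed (use g in \<open>simp add: N0_def\<close>)
  then have inv_meas: "the_inv_into M0 f \<in> measurable (restrict_space N N0) (restrict_space M M0)"
    using inv by (subst measurable_cong[where g=g]) (auto simp: sp)
  \<comment> \<open>\<open>M0\<close> is conull, so intersecting a preimage with it keeps the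
    measure. This identifies the pushforward on \<open>N0\<close>, and \<open>E = N0\<close> shows
    that \<open>N0\<close> has full measure.\<close>
  have E: "emeasure M (f -` E \<inter> M0) = emeasure N E" if "E \<in> sets N" for E
  proof -
    have "f -` E \<inter> M0 = (f -` E \<inter> space M) \<inter> M0" by (auto simp: M0_def)
    then have "f -` E \<inter> M0 \<in> sets M" using measurable_sets[OF f that] M0s by auto
    then have "emeasure M (f -` E \<inter> M0) = emeasure M (f -` E \<inter> space M)"
      using measurable_sets[OF f that] ae
      by (intro emeasure_eq_AE) (auto simp: M0_def)
    also have "\<dots> = emeasure (distr M N f) E" using f that by (simp add: emeasure_distr)
    finally show ?thesis by (simp add: N)
  qed
  have "distr (restrict_space M M0) (restrict_space N N0) f = restrict_space N N0"
  proof (rule measure_eqI)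
    fix E assume "E \<in> sets (distr (restrict_space M M0) (restrict_space N N0) f)"
    then have E': "E \<in> sets (restrict_space N N0)" by simp
    then have EN: "E \<subseteq> N0" "E \<in> sets N"
      using N0s by (auto simp: sets_restrict_space_iff)
    have "emeasure (distr (restrict_space M M0) (restrict_space N N0) f) E =
        emeasure M (f -` E \<inter> M0)"
      using E' M0s by (simp add: emeasure_distr[OF f0] sp emeasure_restrict_space)
    then show "emeasure (distr (restrict_space M M0) (restrict_space N N0) f) E =
        emeasure (restrict_space N N0) E"
      using E[OF EN(2)] EN N0s by (simp add: emeasure_restrict_space)
  qed simp
  moreover have "f -` N0 \<inter> M0 = M0" using bij by (auto dest: bij_betwE)
  then have "emeasure N N0 = 1" using E[OF N0s] M01 by simp
  moreover have "S ` M0 \<subseteq> M0" "T ` N0 \<subseteq> N0"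
    using S T fsp by (auto simp: M0_def N0_def)
  ultimately show ?thesis
    unfolding measure_isomorphism_def
    using M0s N0s M01 bij f0 inv_meas S(2) by (intro bexI[of _ M0] bexI[of _ N0]) (auto simp: M0_def)
qed

section \<open>Integer translations of the odometer\<close>

context odometer_scale
begin

text \<open>Negative \<open>i\<close> are needed to reach the negative coordinates of a sequence;
  the detour through \<open>int\<close> yields a true residue when \<open>z n + i\<close> is
  negative.\<close>

definition rotate_odometer :: "int \<Rightarrow> (nat \<Rightarrow> nat) \<Rightarrow> (nat \<Rightarrow> nat)" where
  "rotate_odometer i z = (\<lambda>n. nat ((int (z n) + i) mod int (h n)))"

lemma rotate_odometer_odometer:
  assumes "z \<in> odometer h"
  shows "rotate_odometer i z \<in> odometer h"
  unfolding odometer_def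
proof (intro CollectI conjI allI impI)
  fix n show "rotate_odometer i z n < h n"
    using pos by (simp add: rotate_odometer_def nat_less_iff)
next
  fix m n :: nat assume mn: "m \<le> n"
  have "int (rotate_odometer i z n mod h m) = ((int (z n) + i) mod int (h n)) mod int (h m)"
    using pos[of n] by (simp add: rotate_odometer_def zmod_int)
  also have "\<dots> = (int (z n) + i) mod int (h m)"
    using dvd[OF mn] by (simp add: mod_mod_cancel)
  also have "\<dots> = (int (z n mod h m) + i) mod int (h m)"
    by (simp add: zmod_int mod_add_left_eq)
  also have "z n mod h m = z m" using assms mn by (auto simp: odometer_def)
  finally show "rotate_odometer i z n mod h m = rotate_odometer i z m"
    using pos[of m] by (simp add: rotate_odometer_def)
qed

lemma rotate_odometer_0: "z \<in> odometer h \<Longrightarrow> rotate_odometer 0 z = z"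
  using odometer_less by (fastforce simp: rotate_odometer_def)

lemma rotate_odometer_succ: "rotate_odometer i (odometer_succ h z) = rotate_odometer (i + 1) z"
proof
  fix n
  have "(int ((z n + 1) mod h n) + i) mod int (h n) = (int (z n + 1) + i) mod int (h n)"
    by (simp only: zmod_int mod_add_left_eq)
  then show "rotate_odometer i (odometer_succ h z) n = rotate_odometer (i + 1) z n"
    by (simp add: rotate_odometer_def odometer_succ_def ac_simps)
qed

lemma odometer_succ_odometer: "z \<in> odometer h \<Longrightarrow> odometer_succ h z \<in> odometer h"
proof -
  assume z: "z \<in> odometer h"
  have "rotate_odometer 1 z = odometer_succ h z"
    by (rule ext) (simp add: rotate_odometer_def odometer_succ_def nat_mod_distrib nat_add_distrib)
  then show ?thesis using rotate_odometer_odometer[OF z, of 1] by simp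
qed

lemma measurable_rotate_odometer: "rotate_odometer i \<in> measurable borel_odometer borel_odometer"
proof (rule measurable_odometer)
  fix n k
  have "{z \<in> space borel_odometer. rotate_odometer i z n = k} =
      (\<Union>l\<in>{l. nat ((int l + i) mod int (h n)) = k}. cylinder n l)"
    by (auto simp: topspace_odometer rotate_odometer_def cylinder_def)
  then show "{z \<in> space borel_odometer. rotate_odometer i z n = k} \<in> sets borel_odometer" by simp
qed (simp add: topspace_odometer rotate_odometer_odometer)

end

sublocale recognizable_directive \<subseteq> odometer_scale "tower_height A \<tau>"
  by unfold_locales (simp_all add: height_pos height_dvd)

section \<open>Invariant measures and their image in the odometer\<close>

locale invariant_directive = recognizable_directive A \<tau>
  for A :: "nat \<Rightarrow> 'a set" and \<tau> +
  fixes \<mu> :: "(int \<Rightarrow> 'a) measure"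
  assumes borel: "borel_probability (subshift_topology A \<tau>) \<mu>"
    and invariant: "invariant_measure shift_map \<mu>"
begin

sublocale prob_space \<mu>
  using borel by (simp add: borel_probability_def)

lemma sets_mu: "sets \<mu> = sets (borel_measure_space (subshift_topology A \<tau>))"
  using borel by (simp add: borel_probability_def)

lemma space_mu: "space \<mu> = X"
  using sets_eq_imp_space_eq[OF sets_mu] by (simp add: topspace_subshift_topology)

lemma level_sets_mu [measurable]: "a \<in> A n \<Longrightarrow> level A \<tau> n (a, k) \<in> sets \<mu>"
  by (simp add: sets_mu level_sets)

lemma measurable_shift: "shift_map \<in> measurable \<mu> \<mu>"
  and distr_shift: "distr \<mu> \<mu> shift_map = \<mu>"
  using invariant by (auto simp: invariant_measure_def)

lemma level_Suc: "level A \<tau> n (a, Suc k) = shift_map ` level A \<tau> n (a, k)"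
  by (simp add: level_def image_image)

lemma inj_shift_map: "inj (shift_map :: (int \<Rightarrow> 'b) \<Rightarrow> _)"
proof (rule injI, rule ext)
  fix x y :: "int \<Rightarrow> 'b" and i assume "shift_map x = shift_map y"
  then have "shift_map x (i - 1) = shift_map y (i - 1)" by simp
  then show "x i = y i" by (simp add: shift_map_def)
qed

text \<open>The shift is injective, so the preimage of a floor is the floor below it, and invariance
  equates their masses.\<close>

lemma measure_level:
  assumes a: "a \<in> A n"
  shows "measure \<mu> (level A \<tau> n (a, k)) = measure \<mu> (level A \<tau> n (a, 0))"
proof (induction k)
  case (Suc k)
  have "measure \<mu> (level A \<tau> n (a, Suc k)) = measure (distr \<mu> \<mu> shift_map) (level A \<tau> n (a, Suc k))"
    by (simp add: distr_shift)
  also have "\<dots> = measure \<mu> (shift_map -` level A \<tau> n (a, Suc k) \<inter> space \<mu>)"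
    using a by (intro measure_distr measurable_shift level_sets_mu)
  also have "shift_map -` level A \<tau> n (a, Suc k) \<inter> space \<mu> = level A \<tau> n (a, k)"
    using level_subset[OF a, of k] inj_shift_map by (auto simp: level_Suc space_mu dest: injD)
  finally show ?case using Suc by simp
qed simp

text \<open>Converts a lower bound \<open>\<delta>\<close> on a tower into the bound
  \<open>\<delta> / height n\<close> on each of its floors.\<close>

lemma measure_tower:
  assumes a: "a \<in> A n"
  shows "measure \<mu> (tower A \<tau> n a) = real (height n) * measure \<mu> (level A \<tau> n (a, k))"
  unfolding tower_eq[OF a]
proof (rule measure_UN_lessThan_const[OF prob_space_axioms])
  show "disjoint_family_on (\<lambda>k. level A \<tau> n (a, k)) {..<height n}"
    unfolding disjoint_family_on_def using levels_disjoint(2) a by blast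
  show "measure \<mu> (level A \<tau> n (a, j)) = measure \<mu> (level A \<tau> n (a, k))" for j
    using measure_level[OF a] by metis
qed (use a in simp)

lemma pi_meq_fibre_sets [measurable]:
  assumes "k < height n"
  shows "{x \<in> X. pi_meq A \<tau> x n = k} \<in> sets \<mu>"
  unfolding pi_meq_fibre[OF assms] using finite_alphabet by auto

text \<open>A fibre consists of one floor from every tower, so its mass does not depend on
  \<open>k\<close>, and the \<open>height n\<close> fibres partition \<open>X\<close>.\<close>

lemma measure_pi_meq_fibre:
  assumes k: "k < height n"
  shows "measure \<mu> {x \<in> X. pi_meq A \<tau> x n = k} = 1 / real (height n)"
proof -
  define c where "c = (\<Sum>a\<in>A n. measure \<mu> (level A \<tau> n (a, 0)))"
  have c: "measure \<mu> {x \<in> X. pi_meq A \<tau> x n = j} = c" if j: "j < height n" for j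
  proof -
    have "measure \<mu> (\<Union>a\<in>A n. level A \<tau> n (a, j)) = (\<Sum>a\<in>A n. measure \<mu> (level A \<tau> n (a, j)))"
    proof (rule finite_measure_finite_Union)
      show "disjoint_family_on (\<lambda>a. level A \<tau> n (a, j)) (A n)"
        unfolding disjoint_family_on_def
      proof (intro ballI impI)
        fix a b assume "a \<in> A n" "b \<in> A n" "a \<noteq> b"
        then have "x \<notin> level A \<tau> n (b, j)" if "x \<in> level A \<tau> n (a, j)" for x
          using levels_disjoint(1)[OF that] j by metis
        then show "level A \<tau> n (a, j) \<inter> level A \<tau> n (b, j) = {}" by blast
      qed
    qed (auto simp: finite_alphabet)
    also have "\<dots> = c" unfolding c_def using measure_level by (rule sum.cong[OF refl])
    finally show ?thesis by (simp only: pi_meq_fibre[OF j])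
  qed
  have "(\<Union>j<height n. {x \<in> X. pi_meq A \<tau> x n = j}) = X" using pi_meq_less by auto
  then have "1 = measure \<mu> (\<Union>j<height n. {x \<in> X. pi_meq A \<tau> x n = j})"
    using prob_space by (simp add: space_mu)
  also have "\<dots> = real (height n) * c"
  proof (rule measure_UN_lessThan_const[OF prob_space_axioms])
    show "disjoint_family_on (\<lambda>j. {x \<in> X. pi_meq A \<tau> x n = j}) {..<height n}"
      by (auto simp: disjoint_family_on_def)
  qed (fact pi_meq_fibre_sets c)+
  finally show ?thesis using c[OF k] height_pos[of n] by (simp add: field_simps)
qed

lemma measurable_pi_meq: "pi_meq A \<tau> \<in> measurable \<mu> borel_odometer"
  by (rule measurable_odometer) (auto simp: space_mu pi_meq_odometer)

abbreviation haar :: "(nat \<Rightarrow> nat) measure" where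
  "haar \<equiv> odometer_haar (tower_height A \<tau>)"

lemma haar_eq: "haar = distr \<mu> borel_odometer (pi_meq A \<tau>)"
proof (rule odometer_haar_eq)
  show "borel_probability (odometer_topology height) (distr \<mu> borel_odometer (pi_meq A \<tau>))"
    using prob_space_distr[OF measurable_pi_meq] by (simp add: borel_probability_def)
  fix n k assume k: "k < height n"
  have "pi_meq A \<tau> -` cylinder n k \<inter> space \<mu> = {x \<in> X. pi_meq A \<tau> x n = k}"
    using pi_meq_odometer by (auto simp: cylinder_def space_mu)
  then show "measure (distr \<mu> borel_odometer (pi_meq A \<tau>)) (cylinder n k) = 1 / real (height n)"
    by (simp add: measure_distr[OF measurable_pi_meq] measure_pi_meq_fibre[OF k])
qed

lemma sets_haar: "sets haar = sets borel_odometer"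
  and space_haar: "space haar = odometer height"
  by (simp_all add: haar_eq topspace_odometer)

lemma measure_haar: "E \<in> sets haar \<Longrightarrow> measure haar E = measure \<mu> (pi_meq A \<tau> -` E \<inter> X)"
  unfolding haar_eq by (simp add: measure_distr[OF measurable_pi_meq] space_mu)

lemma measurable_pi_meq_haar: "pi_meq A \<tau> \<in> measurable \<mu> haar"
  using measurable_pi_meq by (simp add: haar_eq)

end

section \<open>From an isomorphism to coincidences\<close>

context invariant_directive
begin

lemma coinc_subset: "coinc (A N) B (seg \<tau> n N) \<subseteq> {..<len n N}"
  by (auto simp: coinc_def)

lemma coinc_ratio_le_1: "real (card (coinc (A N) B (seg \<tau> n N))) / real (len n N) \<le> 1"
proof -
  have "card (coinc (A N) B (seg \<tau> n N)) \<le> len n N"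
    using card_mono[OF _ coinc_subset[of N B n]] by simp
  then show ?thesis by (simp add: divide_le_eq)
qed

text \<open>Positions are counted at two scales: heights \<open>k < height N\<close>, where errors
  have a mass, and indices \<open>i < len n N\<close>, where coincidences live. They are related by
  \<open>i = k div height n\<close>.\<close>

lemma isomorphism_imp_coincidences:
  assumes B: "\<And>N. B N \<noteq> {} \<and> B N \<subseteq> A N"
    and \<delta>: "0 < \<delta>" "\<And>N a. a \<in> B N \<Longrightarrow> \<delta> \<le> measure \<mu> (tower A \<tau> N a)"
    and iso: "measure_isomorphism \<mu> shift_map haar T (pi_meq A \<tau>)"
    and "0 < \<epsilon>"
  shows "eventually (\<lambda>N. 1 - \<epsilon> \<le> real (card (coinc (A N) (B N) (seg \<tau> n N))) / real (len n N)) sequentially"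
proof -
  obtain M0 N0 where M0: "M0 \<in> sets \<mu>" "emeasure \<mu> M0 = 1" and N0: "N0 \<in> sets haar"
    and bij: "bij_betw (pi_meq A \<tau>) M0 N0"
    and inv: "the_inv_into M0 (pi_meq A \<tau>) \<in> measurable (restrict_space haar N0) (restrict_space \<mu> M0)"
    using iso unfolding measure_isomorphism_def by blast
  define \<rho> where "\<rho> = the_inv_into M0 (pi_meq A \<tau>)"
  \<comment> \<open>The part of the odometer that comes from points of \<open>M0\<close> with letter
    \<open>c\<close> at level \<open>n\<close>.\<close>
  define D where "D c = {z \<in> N0. \<rho> z \<in> tower A \<tau> n c}" for c
  have M0X: "M0 \<subseteq> X" using sets.sets_into_space[OF M0(1)] by (simp add: space_mu)
  have tower_sets: "tower A \<tau> n c \<in> sets \<mu>" if "c \<in> A n" for c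
    unfolding tower_eq[OF that] using that by auto
  have D_sets: "D c \<in> sets haar" if c: "c \<in> A n" for c
  proof -
    have "tower A \<tau> n c \<inter> M0 \<in> sets (restrict_space \<mu> M0)"
      using tower_sets[OF c] M0(1) by (simp add: sets_restrict_space_iff)
    then have "\<rho> -` (tower A \<tau> n c \<inter> M0) \<inter> N0 \<in> sets (restrict_space haar N0)"
      using measurable_sets[OF inv] N0 sets.sets_into_space[OF N0]
      unfolding \<rho>_def by (force simp: space_restrict_space Int_absorb2)
    moreover have "\<rho> -` (tower A \<tau> n c \<inter> M0) \<inter> N0 = D c"
      using bij the_inv_into_into[of "pi_meq A \<tau>" M0 _ M0] by (auto simp: D_def \<rho>_def bij_betw_def)
    ultimately show ?thesis using N0 by (simp add: sets_restrict_space_iff)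
  qed
  have D_iff: "pi_meq A \<tau> x \<in> D c \<longleftrightarrow> x \<in> tower A \<tau> n c" if "x \<in> M0" for x c
    using that bij by (auto simp: D_def \<rho>_def bij_betw_def the_inv_into_f_f)
  interpret H: prob_space haar
    unfolding haar_eq by (rule prob_space_distr[OF measurable_pi_meq])
  \<comment> \<open>The \<open>card (A n)\<close> approximation errors add up to at most
    \<open>\<epsilon> * \<delta>\<close>; the factor \<open>\<delta>\<close> will cancel against the
    mass of the floors in error.\<close>
  define \<epsilon>' where "\<epsilon>' = \<epsilon> * \<delta> / real (card (A n))"
  have cardA: "0 < card (A n)" using finite_alphabet alphabet_nonempty by (simp add: card_gt_0_iff)
  have "0 < \<epsilon>'" using \<open>0 < \<epsilon>\<close> \<delta>(1) cardA by (simp add: \<epsilon>'_def)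
  have "\<forall>\<^sub>F N in sequentially. \<exists>K. measure haar (sym_diff (D c) {z \<in> odometer height. z N \<in> K}) < \<epsilon>'"
    if "c \<in> A n" for c
    unfolding eventually_sequentially
    using approximation_by_cylinders[OF H.prob_space_axioms sets_haar D_sets[OF that] \<open>0 < \<epsilon>'\<close>] .
  then have "\<forall>\<^sub>F N in sequentially. \<forall>c\<in>A n.
      \<exists>K. measure haar (sym_diff (D c) {z \<in> odometer height. z N \<in> K}) < \<epsilon>'"
    by (intro eventually_ball_finite finite_alphabet) blast
  then show ?thesis
    using eventually_ge_at_top[of n]
  proof eventually_elim
    case (elim N)
    then have nN: "n \<le> N" by simp
    obtain K where K: "measure haar (sym_diff (D c) {z \<in> odometer height. z N \<in> K c}) < \<epsilon>'"
      if "c \<in> A n" for c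
    proof -
      have "\<forall>c\<in>A n. \<exists>K. measure haar (sym_diff (D c) {z \<in> odometer height. z N \<in> K}) < \<epsilon>'"
        using elim by simp
      from bchoice[OF this] show ?thesis using that by blast
    qed
    define W where "W c = sym_diff (D c) {z \<in> odometer height. z N \<in> K c}" for c
    \<comment> \<open>On \<open>M0\<close> these are the points at which some \<open>K c\<close>
      misjudges the letter of level \<open>n\<close>.\<close>
    define E where "E = pi_meq A \<tau> -` (\<Union>c\<in>A n. W c) \<inter> X"
    have W_sets: "W c \<in> sets haar" if "c \<in> A n" for c
    proof -
      have "{z \<in> odometer height. z N \<in> K c} = (\<Union>k\<in>K c. cylinder N k)"
        by (auto simp: cylinder_def)
      then show ?thesis unfolding W_def using D_sets[OF that] sets_haar by auto
    qed
    have E_sets: "E \<in> sets \<mu>"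
      unfolding E_def space_mu[symmetric] using W_sets finite_alphabet
      by (intro measurable_sets[OF measurable_pi_meq_haar]) auto
    have "measure \<mu> E = measure haar (\<Union>c\<in>A n. W c)"
      unfolding E_def using W_sets finite_alphabet by (intro measure_haar[symmetric]) auto
    also have "\<dots> \<le> (\<Sum>c\<in>A n. measure haar (W c))"
      using W_sets finite_alphabet by (intro H.finite_measure_subadditive_finite) auto
    also have "\<dots> \<le> (\<Sum>c\<in>A n. \<epsilon>')"
      using K by (intro sum_mono) (auto simp: W_def less_imp_le)
    finally have E_le: "measure \<mu> E \<le> \<epsilon> * \<delta>" using cardA by (simp add: \<epsilon>'_def)
    define letter where "letter a k = seg \<tau> n N a ! (k div height n)" for a k
    have letter: "letter a k \<in> A n" if "a \<in> A N" "k < height N" for a k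
    proof -
      have "k div height n < length (seg \<tau> n N a)"
        using that by (simp add: length_seg[OF nN] height_mult[OF nN] less_mult_imp_div_less)
      then show ?thesis using set_seg[OF nN that(1)] by (auto simp: letter_def)
    qed
    \<comment> \<open>A height is bad when the sets \<open>K c\<close> fail to name the letter of
      some tower of \<open>B N\<close> there. At any other height they name the letters of all these
      towers at once, which forces agreement.\<close>
    define Bad where "Bad = {k. k < height N \<and> (\<exists>a\<in>B N. \<exists>c\<in>A n. (k \<in> K c) \<noteq> (c = letter a k))}"
    have "finite Bad" by (simp add: Bad_def)
    obtain \<alpha> where \<alpha>: "\<alpha> k \<in> B N" "\<exists>c\<in>A n. (k \<in> K c) \<noteq> (c = letter (\<alpha> k) k)" if "k \<in> Bad" for k
    proof -
      have "\<forall>k\<in>Bad. \<exists>a. a \<in> B N \<and> (\<exists>c\<in>A n. (k \<in> K c) \<noteq> (c = letter a k))"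
        unfolding Bad_def by blast
      from bchoice[OF this] show ?thesis using that by blast
    qed
    have \<alpha>A: "\<alpha> k \<in> A N" if "k \<in> Bad" for k using \<alpha>(1)[OF that] B by blast
    have Bad_less: "k < height N" if "k \<in> Bad" for k using that by (simp add: Bad_def)
    \<comment> \<open>All points of the floor have residue \<open>k\<close>, so the same
      misjudgement occurs on the whole floor, up to the null set outside \<open>M0\<close>.\<close>
    have sub: "level A \<tau> N (\<alpha> k, k) \<inter> M0 \<subseteq> E" if k: "k \<in> Bad" for k
    proof
      fix x assume x: "x \<in> level A \<tau> N (\<alpha> k, k) \<inter> M0"
      obtain c where c: "c \<in> A n" "(k \<in> K c) \<noteq> (c = letter (\<alpha> k) k)" using \<alpha>(2)[OF k] by blast
      have pi: "pi_meq A \<tau> x N = k" using x \<alpha>A[OF k] Bad_less[OF k] by (intro pi_meq_eq) auto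
      have lev: "x \<in> level A \<tau> n (letter (\<alpha> k) k, k mod height n)"
        using x level_coarser[OF nN \<alpha>A[OF k] Bad_less[OF k]] by (auto simp: letter_def)
      have la: "letter (\<alpha> k) k \<in> A n" using \<alpha>A[OF k] Bad_less[OF k] by (rule letter)
      have "x \<in> tower A \<tau> n c \<longleftrightarrow> c = letter (\<alpha> k) k"
      proof
        assume "x \<in> tower A \<tau> n c"
        then obtain j where "j < height n" "x \<in> level A \<tau> n (c, j)" using c by (auto simp: tower_eq)
        then show "c = letter (\<alpha> k) k"
          using levels_disjoint(1)[OF _ lev] c(1) la height_pos[of n] by simp
      next
        assume "c = letter (\<alpha> k) k"
        then show "x \<in> tower A \<tau> n c" using lev la height_pos[of n] by (auto simp: tower_eq)
      qed
      moreover have "x \<in> X" "pi_meq A \<tau> x \<in> odometer height"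
        using x M0X pi_meq_odometer by auto
      ultimately show "x \<in> E" using c D_iff[of x c] x pi by (auto simp: E_def W_def)
    qed
    have level_ge: "\<delta> / real (height N) \<le> measure \<mu> (level A \<tau> N (\<alpha> k, k))" if "k \<in> Bad" for k
      using \<delta>(2)[OF \<alpha>(1)[OF that]] measure_tower[OF \<alpha>A[OF that], of k] height_pos[of N]
      by (simp add: divide_le_eq mult.commute)
    \<comment> \<open>One floor is taken for each bad height. Floors at distinct heights are
      disjoint, even in different towers, so their masses add.\<close>
    have "real (card Bad) * (\<delta> / real (height N)) \<le> (\<Sum>k\<in>Bad. measure \<mu> (level A \<tau> N (\<alpha> k, k)))"
      using level_ge by (intro sum_bounded_below) auto
    also have "\<dots> = measure \<mu> (\<Union>k\<in>Bad. level A \<tau> N (\<alpha> k, k))"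
    proof (rule finite_measure_finite_Union[symmetric])
      show "disjoint_family_on (\<lambda>k. level A \<tau> N (\<alpha> k, k)) Bad"
        unfolding disjoint_family_on_def
      proof (intro ballI impI)
        fix j k assume jk: "j \<in> Bad" "k \<in> Bad" "j \<noteq> k"
        have "x \<notin> level A \<tau> N (\<alpha> k, k)" if "x \<in> level A \<tau> N (\<alpha> j, j)" for x
          using levels_disjoint(2)[OF that] jk \<alpha>A Bad_less by blast
        then show "level A \<tau> N (\<alpha> j, j) \<inter> level A \<tau> N (\<alpha> k, k) = {}" by blast
      qed
    qed (auto simp: \<open>finite Bad\<close> intro: level_sets_mu \<alpha>A)
    also have "\<dots> \<le> measure \<mu> (E \<union> (X - M0))"
      using sub E_sets M0(1) level_subset \<alpha>A
      by (intro finite_measure_mono) (blast, simp add: space_mu[symmetric] sets.Un sets.compl_sets)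
    also have "\<dots> \<le> measure \<mu> E + measure \<mu> (X - M0)"
      using E_sets M0(1) by (intro measure_Un_le) (auto simp: space_mu[symmetric])
    also have "measure \<mu> (X - M0) = 0"
      using prob_compl[OF M0(1)] M0(2) by (simp add: space_mu emeasure_eq_measure)
    finally have "real (card Bad) * (\<delta> / real (height N)) \<le> \<epsilon> * \<delta>" using E_le by simp
    then have Bad_le: "real (card Bad) \<le> \<epsilon> * real (height N)"
      using \<delta>(1) height_pos[of N] by (simp add: field_simps)
    define C where "C = coinc (A N) (B N) (seg \<tau> n N)"
    have good: "k div height n \<in> C" if "k < height N" "k \<notin> Bad" for k
      unfolding C_def coinc_def
    proof (intro CollectI conjI ballI)
      show "k div height n < len n N"
        using that(1) by (simp add: height_mult[OF nN] less_mult_imp_div_less)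
      fix a b assume ab: "a \<in> B N" "b \<in> B N"
      then have "letter a k \<in> A n" using letter B that(1) by blast
      then have "letter a k = letter b k" using that ab unfolding Bad_def by blast
      then show "seg \<tau> n N a ! (k div height n) = seg \<tau> n N b ! (k div height n)"
        by (simp add: letter_def)
    qed
    have "finite C" using finite_subset[OF coinc_subset] by (auto simp: C_def)
    \<comment> \<open>Each coincidence accounts for at most \<open>height n\<close> good heights,
      one for each remainder.\<close>
    have "height N - card Bad \<le> card ({..<height N} - Bad)"
      using diff_card_le_card_Diff[OF \<open>finite Bad\<close>, of "{..<height N}"] by simp
    also have "\<dots> \<le> card (C \<times> {..<height n})"
    proof (rule card_inj_on_le)
      show "inj_on (\<lambda>k. (k div height n, k mod height n)) ({..<height N} - Bad)"
        by (rule inj_onI) (metis div_mult_mod_eq prod.inject)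
      show "(\<lambda>k. (k div height n, k mod height n)) ` ({..<height N} - Bad) \<subseteq> C \<times> {..<height n}"
        using good height_pos[of n] by auto
    qed (simp add: \<open>finite C\<close>)
    finally have "real (height N) - real (card Bad) \<le> real (card C) * real (height n)"
      by (simp add: card_cartesian_product of_nat_mult[symmetric] del: of_nat_mult)
    then have "(1 - \<epsilon>) * real (len n N) * real (height n) \<le> real (card C) * real (height n)"
      using Bad_le by (simp add: height_mult[OF nN] algebra_simps)
    then have "(1 - \<epsilon>) * real (len n N) \<le> real (card C)"
      using height_pos[of n] by simp
    then show ?case using len_pos[OF nN] by (simp add: C_def pos_le_divide_eq)
  qed
qed

end

section \<open>From coincidences to an isomorphism\<close>

context invariant_directive
begin

text \<open>Invariance of \<open>\<mu>\<close> and equivariance carry the identity from coordinate 0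
  to all coordinates. As \<open>g\<close> takes values in \<open>A 0\<close> everywhere, the rebuilt
  sequence always lies in the full shift, where membership in closed sets can be tested.\<close>

lemma isomorphism_if_letter_determined:
  assumes g: "\<And>z. g z \<in> A 0"
    and g_sets: "\<And>b. b \<in> A 0 \<Longrightarrow> {z \<in> odometer height. g z = b} \<in> sets borel_odometer"
    and ae: "AE x in \<mu>. g (pi_meq A \<tau> x) = x 0"
  shows "measure_isomorphism \<mu> shift_map haar (odometer_succ height) (pi_meq A \<tau>)"
proof -
  \<comment> \<open>The inverse to be: coordinate \<open>i\<close> is the letter read after
    translating by \<open>i\<close>.\<close>
  define G where "G z = (\<lambda>i. g (rotate_odometer i z))" for z
  have G_coord: "{z \<in> odometer height. G z i = b} \<in> sets borel_odometer" if "b \<in> A 0" for i b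
  proof -
    have "rotate_odometer i -` {z \<in> odometer height. g z = b} \<inter> space borel_odometer \<in> sets borel_odometer"
      by (rule measurable_sets[OF measurable_rotate_odometer g_sets[OF that]])
    also have "rotate_odometer i -` {z \<in> odometer height. g z = b} \<inter> space borel_odometer =
        {z \<in> odometer height. G z i = b}"
      using rotate_odometer_odometer by (auto simp: G_def topspace_odometer)
    finally show ?thesis .
  qed
  let ?P = "discrete_product (\<lambda>_::int. A 0)"
  have "G \<in> measurable borel_odometer (borel_measure_space (subtopology ?P {x. \<forall>i. x i \<in> A 0}))"
  proof (rule measurable_discrete_product)
    show "{\<omega> \<in> space borel_odometer. G \<omega> i = b} \<in> sets borel_odometer" if "b \<in> A 0" for i b
      using G_coord[OF that] by (simp add: topspace_odometer)
  qed (auto simp: G_def g finite_alphabet countable_finite)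
  then have G: "G \<in> measurable borel_odometer (borel_measure_space ?P)"
    using subtopology_topspace[of ?P] by (simp add: PiE_UNIV)
  have G_closed: "{z \<in> odometer height. G z \<in> C} \<in> sets borel_odometer" if "closedin ?P C" for C
    using measurable_sets[OF G closedin_sets_borel[OF that]]
    by (simp add: vimage_def Int_def topspace_odometer conj_commute)
  have succ: "G (odometer_succ height z) = shift_map (G z)" for z
    by (rule ext) (simp add: G_def shift_map_def rotate_odometer_succ)
  have x_coord: "{x \<in> X. x i = b} \<in> sets \<mu>" for i b
    unfolding sets_mu subshift_topology_def using subshiftD by (intro coordinate_sets_borel) auto
  have P_sets: "{x \<in> X. G (pi_meq A \<tau> x) i = x i} \<in> sets \<mu>" for i
  proof -
    have "{x \<in> X. G (pi_meq A \<tau> x) i = b} \<in> sets \<mu>" if "b \<in> A 0" for b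
    proof -
      have "pi_meq A \<tau> -` {z \<in> odometer height. G z i = b} \<inter> space \<mu> \<in> sets \<mu>"
        by (rule measurable_sets[OF measurable_pi_meq G_coord[OF that]])
      also have "pi_meq A \<tau> -` {z \<in> odometer height. G z i = b} \<inter> space \<mu> =
          {x \<in> X. G (pi_meq A \<tau> x) i = b}"
        using pi_meq_odometer by (auto simp: space_mu)
      finally show ?thesis .
    qed
    then have "(\<Union>b\<in>A 0. {x \<in> X. G (pi_meq A \<tau> x) i = b} \<inter> {x \<in> X. x i = b}) \<in> sets \<mu>"
      using x_coord finite_alphabet by auto
    also have "(\<Union>b\<in>A 0. {x \<in> X. G (pi_meq A \<tau> x) i = b} \<inter> {x \<in> X. x i = b}) =
        {x \<in> X. G (pi_meq A \<tau> x) i = x i}"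
      using subshiftD by auto
    finally show ?thesis .
  qed
  \<comment> \<open>An equivalence rather than an implication, so that the induction over the
    integers runs both ways from 0.\<close>
  have step: "(AE x in \<mu>. G (pi_meq A \<tau> x) i = x i) \<longleftrightarrow>
      (AE x in \<mu>. G (pi_meq A \<tau> x) (i + 1) = x (i + 1))" for i
  proof -
    have "(AE x in \<mu>. G (pi_meq A \<tau> x) i = x i) \<longleftrightarrow>
        (AE x in distr \<mu> \<mu> shift_map. G (pi_meq A \<tau> x) i = x i)"
      by (simp only: distr_shift)
    also have "\<dots> \<longleftrightarrow> (AE x in \<mu>. G (pi_meq A \<tau> (shift_map x)) i = shift_map x i)"
      using P_sets by (intro AE_distr_iff measurable_shift) (simp add: space_mu)
    also have "\<dots> \<longleftrightarrow> (AE x in \<mu>. G (pi_meq A \<tau> x) (i + 1) = x (i + 1))"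
    proof (rule AE_cong)
      fix x assume "x \<in> space \<mu>"
      then show "(G (pi_meq A \<tau> (shift_map x)) i = shift_map x i) =
          (G (pi_meq A \<tau> x) (i + 1) = x (i + 1))"
        by (simp add: space_mu pi_meq_shift succ) (simp add: shift_map_def)
    qed
    finally show ?thesis .
  qed
  have "AE x in \<mu>. G (pi_meq A \<tau> x) i = x i" for i
  proof (induction i rule: int_induct[where k=0])
    case base
    show ?case
      using ae AE_space
      by eventually_elim (simp add: G_def space_mu rotate_odometer_0 pi_meq_odometer)
  next
    case (step1 i)
    then show ?case using step by blast
  next
    case (step2 i)
    then show ?case using step[of "i - 1"] by simp
  qed
  then have "AE x in \<mu>. \<forall>i. G (pi_meq A \<tau> x) i = x i" by (simp add: AE_all_countable)
  then have aeG: "AE x in \<mu>. G (pi_meq A \<tau> x) = x" by eventually_elim auto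
  define N0 where "N0 = {z \<in> odometer height. G z \<in> X \<and> pi_meq A \<tau> (G z) = z}"
  have N0_sets: "N0 \<in> sets borel_odometer"
  proof -
    \<comment> \<open>The condition \<open>pi_meq A \<tau> (G z) = z\<close> is rewritten as
      membership of \<open>G z\<close> in unions of floors. These are closed, so their preimages
      under \<open>G\<close> are measurable.\<close>
    have lev: "{z \<in> odometer height. G z \<in> (\<Union>a\<in>A n. level A \<tau> n (a, k))} \<in> sets borel_odometer" for n k
      using closedin_level finite_alphabet by (intro G_closed closedin_Union) auto
    have "(\<Inter>n. \<Union>k<height n.
        {z \<in> odometer height. G z \<in> (\<Union>a\<in>A n. level A \<tau> n (a, k))} \<inter> cylinder n k) \<in> sets borel_odometer"
      using lev by (intro sets.countable_INT' image_subsetI sets.finite_UN sets.Int) auto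
    then have "{z \<in> odometer height. G z \<in> X} \<inter> (\<Inter>n. \<Union>k<height n.
        {z \<in> odometer height. G z \<in> (\<Union>a\<in>A n. level A \<tau> n (a, k))} \<inter> cylinder n k) \<in> sets borel_odometer"
      using G_closed[OF closedin_subshift] by (rule sets.Int[rotated])
    also have "{z \<in> odometer height. G z \<in> X} \<inter> (\<Inter>n. \<Union>k<height n.
        {z \<in> odometer height. G z \<in> (\<Union>a\<in>A n. level A \<tau> n (a, k))} \<inter> cylinder n k) = N0"
    proof -
      have "z \<in> (\<Union>k<height n. {z \<in> odometer height. G z \<in> (\<Union>a\<in>A n. level A \<tau> n (a, k))} \<inter> cylinder n k)
          \<longleftrightarrow> pi_meq A \<tau> (G z) n = z n" if z: "z \<in> odometer height" "G z \<in> X" for z n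
      proof -
        have "G z \<in> (\<Union>a\<in>A n. level A \<tau> n (a, k)) \<longleftrightarrow> pi_meq A \<tau> (G z) n = k" if "k < height n" for k
          unfolding pi_meq_fibre[OF that, symmetric] using z by simp
        then show ?thesis using z odometer_less[OF z(1), of n] by (auto simp: cylinder_def)
      qed
      then show ?thesis unfolding N0_def by (intro set_eqI) (auto simp del: UN_iff)
    qed
    finally show ?thesis .
  qed
  show ?thesis
  proof (rule measure_isomorphismI[where g=G])
    show "prob_space \<mu>" by (rule prob_space_axioms)
    show "pi_meq A \<tau> \<in> measurable \<mu> haar" by (rule measurable_pi_meq_haar)
    show "distr \<mu> haar (pi_meq A \<tau>) = haar"
      unfolding haar_eq by (rule distr_cong) auto
    show "{x \<in> space \<mu>. G (pi_meq A \<tau> x) = x} \<in> sets \<mu>"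
    proof -
      have "(\<Inter>i. {x \<in> X. G (pi_meq A \<tau> x) i = x i}) \<in> sets \<mu>"
        using P_sets by (intro sets.countable_INT' image_subsetI) auto
      also have "(\<Inter>i. {x \<in> X. G (pi_meq A \<tau> x) i = x i}) = {x \<in> space \<mu>. G (pi_meq A \<tau> x) = x}"
        by (auto simp: space_mu fun_eq_iff)
      finally show ?thesis .
    qed
    show "{z \<in> space haar. G z \<in> space \<mu> \<and> pi_meq A \<tau> (G z) = z} \<in> sets haar"
      using N0_sets by (simp add: space_haar space_mu sets_haar N0_def)
    have "G \<in> measurable (restrict_space haar N0) (borel_measure_space (subtopology ?P X))"
    proof (rule measurable_discrete_product)
      fix i b assume "b \<in> A 0"
      have "space (restrict_space haar N0) = N0"
        by (auto simp: space_restrict_space space_haar N0_def)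
      then have "{z \<in> space (restrict_space haar N0). G z i = b} = {z \<in> odometer height. G z i = b} \<inter> N0"
        by (auto simp: N0_def)
      then show "{z \<in> space (restrict_space haar N0). G z i = b} \<in> sets (restrict_space haar N0)"
        using G_coord[OF \<open>b \<in> A 0\<close>, of i] N0_sets by (simp add: sets_restrict_space_iff sets_haar)
    next
      fix z assume "z \<in> space (restrict_space haar N0)"
      then show "G z \<in> X" by (auto simp: space_restrict_space N0_def)
    qed (auto simp: finite_alphabet countable_finite subshiftD)
    then show "G \<in> measurable
        (restrict_space haar {z \<in> space haar. G z \<in> space \<mu> \<and> pi_meq A \<tau> (G z) = z}) \<mu>"
      using sets_mu by (simp add: space_haar space_mu N0_def subshift_topology_def cong: measurable_cong_sets)
  qed (auto simp: space_mu space_haar shift_map_X pi_meq_shift odometer_succ_odometer succ aeG)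
qed

text \<open>The letter at 0 is recovered as the eventual value of functions of a single residue
  each, so its measurability comes from countable operations on cylinders.\<close>

lemma coincidences_imp_isomorphism:
  assumes B: "\<And>N. B N \<noteq> {} \<and> B N \<subseteq> A N"
    and summable: "summable (\<lambda>n. measure \<mu> (X - (\<Union>a\<in>B n. tower A \<tau> n a)))"
    and lim: "limsup (\<lambda>N. ereal (real (card (coinc (A N) (B N) (seg \<tau> 0 N))) / real (len 0 N))) = 1"
  shows "measure_isomorphism \<mu> shift_map haar (odometer_succ height) (pi_meq A \<tau>)"
proof -
  define r where "r N = real (card (coinc (A N) (B N) (seg \<tau> 0 N))) / real (height N)" for N
  \<comment> \<open>The error \<open>(1/2) ^ j\<close> is chosen to be summable, and
    \<open>j \<le> N\<close> will send the levels to infinity.\<close>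
  have "\<exists>N\<ge>j. 1 - (1/2) ^ j < r N" for j :: nat
  proof (rule ccontr)
    assume "\<not> ?thesis"
    then have "\<forall>\<^sub>F N in sequentially. ereal (r N) \<le> ereal (1 - (1/2) ^ j)"
      unfolding eventually_sequentially by (auto simp: not_less)
    then have "limsup (\<lambda>N. ereal (r N)) \<le> ereal (1 - (1/2) ^ j)" by (rule Limsup_bounded)
    then show False
      using lim zero_less_power[of "1/2::real" j] by (simp add: r_def height_eq one_ereal_def not_le[symmetric])
  qed
  then obtain N where N: "\<And>j. j \<le> N j" "\<And>j. 1 - (1/2) ^ j < r (N j)" by metis
  define C where "C j = coinc (A (N j)) (B (N j)) (seg \<tau> 0 (N j))" for j
  have C: "C j \<subseteq> {..<height (N j)}" for j
    unfolding C_def height_eq by (rule coinc_subset)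
  \<comment> \<open>A reference letter: at a coincidence every letter of \<open>B (N j)\<close>
    gives the same reading.\<close>
  obtain \<alpha> where \<alpha>: "\<And>j. \<alpha> j \<in> B (N j)"
  proof -
    have "\<forall>j. \<exists>a. a \<in> B (N j)" using B by blast
    from choice[OF this] show ?thesis using that by blast
  qed
  define letter where "letter j z = seg \<tau> 0 (N j) (\<alpha> j) ! z (N j)" for j and z :: "nat \<Rightarrow> nat"
  define F where "F j = {x \<in> X. pi_meq A \<tau> x (N j) \<notin> C j}" for j
  have F_eq: "F j = (\<Union>k\<in>{..<height (N j)} - C j. {x \<in> X. pi_meq A \<tau> x (N j) = k})" for j
    using pi_meq_less by (auto simp: F_def)
  have F_sets: "F j \<in> sets \<mu>" for j unfolding F_eq by auto
  have F_le: "measure \<mu> (F j) \<le> (1/2) ^ j" for j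
  proof -
    have "measure \<mu> (F j) \<le> (\<Sum>k\<in>{..<height (N j)} - C j. measure \<mu> {x \<in> X. pi_meq A \<tau> x (N j) = k})"
      unfolding F_eq by (rule finite_measure_subadditive_finite) auto
    also have "\<dots> = real (card ({..<height (N j)} - C j)) * (1 / real (height (N j)))"
      by (simp add: measure_pi_meq_fibre)
    also have "card ({..<height (N j)} - C j) = height (N j) - card (C j)"
      using C[of j] finite_subset[OF C[of j]] by (simp add: card_Diff_subset)
    also have "real (height (N j) - card (C j)) * (1 / real (height (N j))) = 1 - r (N j)"
      using card_mono[OF _ C, of j] height_pos[of "N j"]
      by (simp add: r_def C_def of_nat_diff diff_divide_distrib)
    finally show ?thesis using N(2)[of j] by simp
  qed
  have "summable (\<lambda>j. measure \<mu> (F j))"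
    using F_le by (intro summable_comparison_test[OF _ summable_geometric[of "1/2::real"]]) auto
  then have ae1: "AE x in \<mu>. \<forall>\<^sub>F j in sequentially. x \<in> space \<mu> - F j"
    by (intro borel_cantelli_AE1 F_sets) (simp_all add: emeasure_eq_measure)
  define L where "L n = X - (\<Union>a\<in>B n. tower A \<tau> n a)" for n
  have L_sets: "L n \<in> sets \<mu>" for n
  proof -
    have "tower A \<tau> n a \<in> sets \<mu>" if "a \<in> B n" for a
    proof -
      have "a \<in> A n" using that B by blast
      then show ?thesis by (simp add: tower_eq)
    qed
    moreover have "finite (B n)" using B finite_alphabet finite_subset by metis
    ultimately show ?thesis unfolding L_def space_mu[symmetric] by auto
  qed
  have ae2: "AE x in \<mu>. \<forall>\<^sub>F n in sequentially. x \<in> space \<mu> - L n"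
    using summable by (intro borel_cantelli_AE1 L_sets) (simp_all add: emeasure_eq_measure L_def)
  have letter_eq: "letter j (pi_meq A \<tau> x) = x 0" if x: "x \<in> X" "x \<notin> F j" "x \<notin> L (N j)" for x j
  proof -
    obtain a where a: "a \<in> B (N j)" "x \<in> tower A \<tau> (N j) a"
      using x by (auto simp: L_def)
    have aA: "a \<in> A (N j)" using a B by blast
    obtain k where k: "k < height (N j)" "x \<in> level A \<tau> (N j) (a, k)"
      using a(2) unfolding tower_eq[OF aA] by auto
    have pi: "pi_meq A \<tau> x (N j) = k" using pi_meq_eq[OF k(2) aA k(1)] .
    then have "k \<in> C j" using x by (simp add: F_def)
    then have "seg \<tau> 0 (N j) (\<alpha> j) ! k = seg \<tau> 0 (N j) a ! k"
      using \<alpha>[of j] a(1) unfolding C_def coinc_def by blast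
    then show ?thesis using level_letter[OF k(2) aA k(1)] by (simp add: letter_def pi)
  qed
  define ev where "ev b z \<longleftrightarrow> (\<forall>\<^sub>F j in sequentially. letter j z = b)" for b z
  have ev_unique: "b = c" if "ev b z" "ev c z" for b c z
  proof -
    have "\<forall>\<^sub>F j::nat in sequentially. b = c" using that unfolding ev_def by eventually_elim simp
    then show ?thesis by simp
  qed
  obtain a0 where a0: "a0 \<in> A 0" using alphabet_nonempty by blast
  \<comment> \<open>The default \<open>a0\<close>, taken where the readings settle on no letter of
    \<open>A 0\<close>, keeps all values of \<open>g\<close> in \<open>A 0\<close>.\<close>
  define g where "g z = (if \<exists>b\<in>A 0. ev b z then THE b. ev b z else a0)" for z
  have g_ev: "g z = b" if "ev b z" "b \<in> A 0" for b z
    using that ev_unique by (auto simp: g_def intro!: the_equality)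
  have g_not: "g z = a0" if "\<forall>b\<in>A 0. \<not> ev b z" for z using that by (auto simp: g_def)
  have ev_sets: "{z \<in> odometer height. ev b z} \<in> sets borel_odometer" for b
  proof -
    have "{z \<in> odometer height. letter j z = b} \<in> sets borel_odometer" for j
    proof -
      have "{z \<in> odometer height. letter j z = b} =
          (\<Union>k\<in>{k. seg \<tau> 0 (N j) (\<alpha> j) ! k = b}. cylinder (N j) k)"
        by (auto simp: letter_def cylinder_def)
      then show ?thesis by simp
    qed
    then have "(\<Union>J. \<Inter>j\<in>{J..}. {z \<in> odometer height. letter j z = b}) \<in> sets borel_odometer"
      by (intro sets.countable_UN sets.countable_INT') auto
    also have "(\<Union>J. \<Inter>j\<in>{J..}. {z \<in> odometer height. letter j z = b}) = {z \<in> odometer height. ev b z}"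
      by (auto simp: ev_def eventually_sequentially)
    finally show ?thesis .
  qed
  show ?thesis
  proof (rule isomorphism_if_letter_determined[where g=g])
    show "g z \<in> A 0" for z using g_ev g_not a0 by metis
    fix b assume b: "b \<in> A 0"
    \<comment> \<open>The points receiving the default belong to the fibre of \<open>a0\<close>
      alone.\<close>
    have "{z \<in> odometer height. g z = b} = {z \<in> odometer height. ev b z} \<union>
        (if b = a0 then odometer height - (\<Union>c\<in>A 0. {z \<in> odometer height. ev c z}) else {})"
    proof -
      have "g z = b \<longleftrightarrow> ev b z \<or> b = a0 \<and> (\<forall>c\<in>A 0. \<not> ev c z)" for z
        using g_ev[of _ z] g_not[of z] b by metis
      then show ?thesis by auto
    qed
    moreover have "odometer height \<in> sets borel_odometer"
      using sets.top[of borel_odometer] by (simp add: topspace_odometer)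
    ultimately show "{z \<in> odometer height. g z = b} \<in> sets borel_odometer"
      using ev_sets finite_alphabet
      by (auto intro!: sets.Un sets.Diff sets.finite_UN)
  next
    show "AE x in \<mu>. g (pi_meq A \<tau> x) = x 0"
      using ae1 ae2 AE_space
    proof eventually_elim
      case (elim x)
      \<comment> \<open>What holds for all large levels holds along the levels \<open>N j\<close>,
        since \<open>j \<le> N j\<close>.\<close>
      have "\<forall>\<^sub>F j in sequentially. x \<in> space \<mu> - L (N j)"
        using elim(2) N(1) unfolding eventually_sequentially by (meson order_trans)
      with elim(1) have "ev (x 0) (pi_meq A \<tau> x)"
        unfolding ev_def by eventually_elim (auto simp: space_mu letter_eq)
      then show ?case using elim(3) subshiftD by (intro g_ev) (auto simp: space_mu)
    qed
  qed
qed

end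

section \<open>The equivalence\<close>

theorem theorem2:
  fixes A A' :: "nat \<Rightarrow> 'a set" and \<tau> :: "nat \<Rightarrow> 'a \<Rightarrow> 'a list" and \<mu> :: "(int \<Rightarrow> 'a) measure"
  assumes "directive_sequence A \<tau>"
    and "constant_length_sequence A \<tau>"
    and "recognizable A \<tau>"
    and "primitive_sequence A \<tau>"
    and "subshift A \<tau> 0 \<noteq> {}"
    and "borel_probability (subshift_topology A \<tau>) \<mu>"
    and "ergodic_measure shift_map \<mu>"
    and "\<And>n. A' n \<noteq> {} \<and> A' n \<subseteq> A n"
    and "adapted A \<tau> A' \<mu>"
  shows "measure_isomorphism \<mu> shift_map
           (odometer_haar (tower_height A \<tau>)) (odometer_succ (tower_height A \<tau>)) (pi_meq A \<tau>)
     \<longleftrightarrow>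
         (\<forall>n. limsup (\<lambda>N. ereal (real (card (coinc (A N) (A' N) (seg \<tau> n N)))
                                 / real (morphism_length (A N) (seg \<tau> n N)))) = 1)"
    (is "?iso \<longleftrightarrow> (\<forall>n. limsup (\<lambda>N. ereal (?r n N)) = 1)")
proof -
  interpret invariant_directive A \<tau> \<mu>
    using assms by unfold_locales (simp_all add: ergodic_measure_def)
  obtain \<delta> where \<delta>: "0 < \<delta>" "\<And>N a. a \<in> A' N \<Longrightarrow> \<delta> \<le> measure \<mu> (tower A \<tau> N a)"
    and summable: "summable (\<lambda>n. measure \<mu> (subshift A \<tau> 0 - (\<Union>a\<in>A' n. tower A \<tau> n a)))"
    using assms(9) unfolding adapted_def by blast
  show ?thesis
  proof
    assume iso: ?iso
    show "\<forall>n. limsup (\<lambda>N. ereal (?r n N)) = 1"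
    proof (intro allI antisym)
      fix n
      show "limsup (\<lambda>N. ereal (?r n N)) \<le> 1"
        using coinc_ratio_le_1 by (intro Limsup_bounded always_eventually) (auto simp: one_ereal_def)
      show "1 \<le> limsup (\<lambda>N. ereal (?r n N))"
      \<comment> \<open>It suffices to bound the limsup below by every \<open>y < 1\<close>. A real
        \<open>y = c\<close> is reached with the error \<open>1 - c\<close>, and minus infinity is
        trivial.\<close>
      proof (rule dense_le)
        fix y :: ereal assume "y < 1"
        show "y \<le> limsup (\<lambda>N. ereal (?r n N))"
        proof (cases y)
          case (real c)
          then have "0 < 1 - c" using \<open>y < 1\<close> by (simp add: one_ereal_def)
          then show ?thesis
            using isomorphism_imp_coincidences[OF assms(8) \<delta> iso, of "1 - c" n]
            unfolding real by (intro le_Limsup) (auto elim: eventually_mono)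
        qed (use \<open>y < 1\<close> in auto)
      qed
    qed
  next
    assume "\<forall>n. limsup (\<lambda>N. ereal (?r n N)) = 1"
    then show ?iso by (intro coincidences_imp_isomorphism[OF assms(8) summable]) blast
  qed
qed

end
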